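(* For every $\tau\in\mathbb{H}^2$ set $$f(\tau)=\frac{\eta^4(2\tau)\,\eta^8(3\tau)}{\eta^8(\tau)\,\eta^4(6\tau)} .$$ Then $$\{f,\tau\}+\frac{81f^4-108f^3+102f^2-12f+1}{2(1-9f)^2(f-1)^2f^2}\,(f')^2=0 .$$
   Context: $\mathbb{H}^2=\{\tau\in\mathbb{C}\mid \Im\tau>0\}$; $\eta(\tau)=e^{2\pi i\tau/24}\prod_{n\ge1}(1-e^{2\pi i n\tau})$ is the Dedekind eta function and $\eta^k(m\tau)=(\eta(m\tau))^k$. The prime denotes $d/d\tau$, and the Schwarzian derivative of $y=y(x)$ is $\{y,x\}=\frac{y'''}{y'}-\frac32\left(\frac{y''}{y'}\right)^2$, derivatives being taken with respect to $x$. *)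

theory Defs
  imports "HOL-Analysis.Analysis"
begin

definition upper_half_plane :: "complex set" where
  "upper_half_plane = {\<tau>. Im \<tau> > 0}"

(* The product runs over n >= 1; prodinf starts at index 0, hence the shift Suc n.
   The definition is meaningful for Im tau > 0, where the product converges
   (to a nonzero value). *)
definition dedekind_eta :: "complex \<Rightarrow> complex" where
  "dedekind_eta \<tau> =
     exp (2 * of_real pi * \<i> * \<tau> / 24) *
     (\<Prod>n. 1 - exp (2 * of_real pi * \<i> * of_nat (Suc n) * \<tau>))"

(* schwarzian y x is {y, x}, evaluated at the point x, for a complex function y
   holomorphic near x with nonvanishing derivative at x. *)
definition schwarzian :: "(complex \<Rightarrow> complex) \<Rightarrow> complex \<Rightarrow> complex" where
  "schwarzian y x =
     (deriv ^^ 3) y x / deriv y x - 3 / 2 * ((deriv ^^ 2) y x / deriv y x)\<^sup>2"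

end

theory Submission
  imports Defs "HOL-Complex_Analysis.Complex_Analysis"
begin

text \<open>
  The function \<open>f\<close> is a Hauptmodul for \<open>\<Gamma>\<^sub>0(6)\<close>, and a Schwarzian equation for it expresses that the
  derivatives of modular forms can be computed inside a ring with finitely many generators. The
  proof makes that ring explicit.

  Put \<open>q = exp (2\<pi>\<i>\<tau>)\<close>, let \<open>D = q d/dq\<close>, and let \<open>\<zeta>(u)\<close> be minus the logarithmic derivative of the theta
  product \<open>(1 - z) \<Prod> (1 - q^n z) (1 - q^n / z)\<close> in \<open>z = exp u\<close>, normalized to be odd. Its values
  \<open>X = \<zeta>(\<pi>\<i>/3)\<close> and \<open>Y = \<zeta>(2\<pi>\<i>/3)\<close> at points of finite order are Eisenstein series of weight one that
  generate the modular forms for \<open>\<Gamma>\<^sub>1(6)\<close>; with \<open>Q = - E\<^sub>2 / 12\<close> one gets a ring closed under \<open>D\<close>: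
    \<open>D X = X (X\<^sup>2 - X Y - 5 Y\<^sup>2 - Q)\<close>,
    \<open>D Y = X\<^sup>3 - 3 X\<^sup>2 Y + Y\<^sup>3 - Y Q\<close>,
    \<open>D Q = 6 X\<^sup>2 Y\<^sup>2 - 2 X\<^sup>3 Y + Y\<^sup>4 - Q\<^sup>2\<close>.
  All three follow from one identity, the addition theorem \<open>zeta_addition\<close> for \<open>\<zeta>\<close>, and its limiting
  case \<open>zeta_riccati\<close>. As an identity of
  double Laurent series it is an elementary partial fraction identity between the coefficients
  \<open>1 / (1 - q^n)\<close> (lemma \<open>addition_coeff\<close>). It involves \<open>\<zeta>\<close> and the logarithmic \<open>D\<close>-derivative of
  the same theta product, so that its \<open>u\<close>-derivatives give the \<open>D\<close>-derivatives of \<open>\<zeta>\<close> and \<open>\<zeta>'\<close>. Evaluated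
  at the points of order 2, 3 and 6 it becomes a system of polynomial relations
  (\<open>torsion_relations\<close>).

  The Lambert series for the logarithmic derivative of the eta quotient is a difference of two such
  values, which yields \<open>D f = 2 f (X - 3 Y) (X + Y)\<close>. Comparing with the differential equations above
  and with the limit at \<open>\<i>\<infinity>\<close> identifies \<open>f\<close> with \<open>X / (3 (X - 2 Y))\<close> (\<open>hauptmodul_eq_eis\<close>). Now
  \<open>f\<close>, \<open>D f\<close>, \<open>D\<^sup>2 f\<close> and \<open>D\<^sup>3 f\<close> are rational functions of \<open>X\<close>, \<open>Y\<close>, \<open>Q\<close>, and the Schwarzian equation becomes
  an identity between homogeneous polynomials of weight 4 (\<open>weight_4_identity\<close>).
\<close>

section \<open>Series with geometrically growing coefficients\<close>

text \<open>Requiring a bound for every \<open>r > R\<close>, instead of one bound with \<open>R\<close> itself, makes the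
  condition stable under multiplication by \<open>n\<close>, that is, under termwise differentiation.\<close>

definition geom_growth :: "real \<Rightarrow> (nat \<Rightarrow> complex) \<Rightarrow> bool" where
  "geom_growth R a \<longleftrightarrow> (\<forall>r>R. \<exists>C. \<forall>n. norm (a n) \<le> C * r ^ n)"

lemma geom_growth_mult_n:
  assumes "geom_growth R a" "R \<ge> 0"
  shows "geom_growth R (\<lambda>n. of_nat n * a n)"
  unfolding geom_growth_def
proof (intro allI impI)
  fix r assume r: "r > R"
  define p where "p = (R + r) / 2"
  have p: "R < p" "p < r" "0 < p" using r assms(2) by (auto simp: p_def)
  obtain C where C: "\<And>n. norm (a n) \<le> C * p ^ n" using assms(1) p unfolding geom_growth_def by blast
  have C0: "C \<ge> 0" using order_trans[OF norm_ge_zero C[of 0]] by simp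
  have "(\<lambda>n. of_nat n * (p / r) ^ n) \<longlonglongrightarrow> 0"
    using p by (intro powser_times_n_limit_0) auto
  then have "Bseq (\<lambda>n. real n * (p / r) ^ n)" by (intro convergent_imp_Bseq convergentI)
  then obtain K where K: "\<And>n. norm (real n * (p / r) ^ n) \<le> K" by (auto simp: Bseq_def)
  show "\<exists>C. \<forall>n. norm (of_nat n * a n) \<le> C * r ^ n"
  proof (intro exI allI)
    fix n
    have "norm (of_nat n * a n) \<le> real n * (C * p ^ n)"
      using C[of n] by (simp add: norm_mult mult_left_mono)
    also have "\<dots> = C * (real n * (p / r) ^ n) * r ^ n" using p by (simp add: power_divide)
    also have "\<dots> \<le> C * K * r ^ n"
      using K[of n] p C0 by (intro mult_right_mono mult_left_mono) auto
    finally show "norm (of_nat n * a n) \<le> C * K * r ^ n" .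
  qed
qed

text \<open>Division by zero makes both coefficients vanish at \<open>n = 0\<close>, so series over all natural numbers
  are series over \<open>n \<ge> 1\<close>. The second coefficient arises from the first by differentiation:
  \<open>q d/dq\<close> of \<open>lambert_coeff q n\<close> is \<open>n\<close> times \<open>lambert_coeff_sq q n\<close>.\<close>

definition lambert_coeff :: "complex \<Rightarrow> nat \<Rightarrow> complex" where "lambert_coeff q n = q ^ n / (1 - q ^ n)"
definition lambert_coeff_sq :: "complex \<Rightarrow> nat \<Rightarrow> complex" where "lambert_coeff_sq q n = q ^ n / (1 - q ^ n)\<^sup>2"

lemma norm_one_minus_power:
  assumes "norm (q::complex) < 1" "n > 0"
  shows "1 - norm q \<le> norm (1 - q ^ n)"
proof -
  have "norm q ^ n \<le> norm q ^ 1" using assms by (intro power_decreasing) auto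
  then show ?thesis using norm_triangle_ineq2[of 1 "q^n"] by (simp add: norm_power)
qed

lemma one_minus_power_nonzero: "norm (q::complex) < 1 \<Longrightarrow> n > 0 \<Longrightarrow> 1 - q ^ n \<noteq> 0"
  using norm_one_minus_power[of q n] by auto

lemma norm_lambert_coeff_le: assumes "norm q < 1" shows "norm (lambert_coeff q n) \<le> norm q ^ n / (1 - norm q)"
proof (cases "n = 0")
  case False
  then show ?thesis using norm_one_minus_power[OF assms, of n] assms
    by (auto simp: lambert_coeff_def norm_divide norm_power intro!: divide_left_mono mult_pos_pos)
qed (use assms in \<open>simp add: lambert_coeff_def\<close>)

lemma norm_lambert_coeff_sq_le: assumes "norm q < 1" shows "norm (lambert_coeff_sq q n) \<le> norm q ^ n / (1 - norm q)\<^sup>2"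
proof (cases "n = 0")
  case False
  then have "(1 - norm q)\<^sup>2 \<le> (norm (1 - q ^ n))\<^sup>2"
    using norm_one_minus_power[OF assms, of n] assms by (intro power_mono) auto
  moreover have "(norm (1 - q ^ n))\<^sup>2 > 0" using one_minus_power_nonzero[OF assms, of n] False by simp
  ultimately show ?thesis using assms
    by (auto simp: lambert_coeff_sq_def norm_divide norm_power intro!: divide_left_mono mult_pos_pos)
qed (simp add: lambert_coeff_sq_def)

lemma geom_growth_le:
  assumes "\<And>n. norm (a n) \<le> K * R ^ n" "R \<ge> 0"
  shows "geom_growth R a"
  unfolding geom_growth_def
proof (intro allI impI exI)
  fix r n assume "r > R"
  have "K \<ge> 0" using order_trans[OF norm_ge_zero assms(1)[of 0]] by simp
  then have "K * R ^ n \<le> K * r ^ n" using \<open>r > R\<close> assms(2) by (intro mult_left_mono power_mono) auto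
  then show "norm (a n) \<le> K * r ^ n" using assms(1)[of n] by simp
qed

lemma geom_growth_lambert: "norm q < 1 \<Longrightarrow> geom_growth (norm q) (lambert_coeff q)"
  by (rule geom_growth_le[of _ "1 / (1 - norm q)"]) (use norm_lambert_coeff_le in auto)

lemma geom_growth_lambert_sq: "norm q < 1 \<Longrightarrow> geom_growth (norm q) (lambert_coeff_sq q)"
  by (rule geom_growth_le[of _ "1 / (1 - norm q)\<^sup>2"]) (use norm_lambert_coeff_sq_le in auto)

text \<open>The multiplicative variable \<open>z\<close> of a theta function is written \<open>exp u\<close>, so that the invariant
  derivation \<open>z d/dz\<close> becomes \<open>d/du\<close> and a bilateral Laurent series becomes a sum of exponentials.\<close>

definition bilateral :: "(nat \<Rightarrow> complex) \<Rightarrow> complex \<Rightarrow> complex \<Rightarrow> complex" where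
  "bilateral a s u = (\<Sum>n. a n * (exp (of_nat n * u) + s * exp (- (of_nat n * u))))"

text \<open>The annulus \<open>R < \<bar>z\<bar> < 1/R\<close> in the variable \<open>u\<close> with \<open>z = exp u\<close>.\<close>

definition strip :: "real \<Rightarrow> complex set" where
  "strip R = {u. R * exp \<bar>Re u\<bar> < 1}"

lemma open_strip: "open (strip R)"
proof -
  have "strip R = (\<lambda>u. R * exp \<bar>Re u\<bar>) -` {..<1}" by (auto simp: strip_def)
  then show ?thesis by (simp add: continuous_intros open_vimage)
qed

lemma norm_exp_nat_le: "norm (exp (of_nat n * u)) \<le> exp (\<bar>Re u\<bar>) ^ n"
  by (simp add: mult_left_mono flip: exp_of_nat_mult)

lemma strip_room:
  assumes "u \<in> strip R"
  obtains e where "e > 0" "(R + e) * exp (\<bar>Re u\<bar> + e) < 1"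
proof -
  have "R * exp \<bar>Re u\<bar> < 1" using assms by (simp add: strip_def)
  moreover have "continuous (at_right 0) (\<lambda>e. (R + e) * exp (\<bar>Re u\<bar> + e))"
    by (intro continuous_intros)
  ultimately have "\<forall>\<^sub>F e in at_right 0. (R + e) * exp (\<bar>Re u\<bar> + e) < 1"
    unfolding continuous_within by (intro order_tendstoD(2)) (auto simp: )
  moreover have "\<forall>\<^sub>F e in at_right (0::real). e > 0" by (rule eventually_at_right_less)
  ultimately obtain e where e: "e > 0" "(R + e) * exp (\<bar>Re u\<bar> + e) < 1"
    using eventually_happens'[OF _ eventually_conj] by (metis (no_types, lifting) trivial_limit_at_right_real)
  then show ?thesis using that by blast
qed

lemma bilateral_summable_norm:
  assumes a: "geom_growth R a" "R \<ge> 0" and u: "u \<in> strip R"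
  shows "summable (\<lambda>n. norm (a n * exp (of_nat n * u)))"
proof -
  obtain e where e: "e > 0" "(R + e) * exp (\<bar>Re u\<bar> + e) < 1" using u by (rule strip_room)
  obtain C where C: "\<And>n. norm (a n) \<le> C * (R + e) ^ n"
    using a e unfolding geom_growth_def by (metis less_add_same_cancel1)
  have C0: "C \<ge> 0" using order_trans[OF norm_ge_zero C[of 0]] by simp
  show ?thesis
  proof (rule summable_comparison_test', rule summable_mult, rule summable_geometric)
    show "norm ((R + e) * exp (\<bar>Re u\<bar> + e)) < 1" using e a by simp
    fix n
    have "norm (a n) * norm (exp (of_nat n * u)) \<le> (C * (R + e) ^ n) * exp (\<bar>Re u\<bar>) ^ n"
      by (intro mult_mono C norm_exp_nat_le) (use C0 a e in auto)
    also have "\<dots> \<le> (C * (R + e) ^ n) * exp (\<bar>Re u\<bar> + e) ^ n"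
      by (intro mult_left_mono power_mono) (use C0 a e in auto)
    finally show "norm (norm (a n * exp (of_nat n * u))) \<le> C * ((R + e) * exp (\<bar>Re u\<bar> + e)) ^ n"
      by (simp add: norm_mult power_mult_distrib)
  qed
qed

lemma bilateral_summand_bound:
  assumes "norm (a n) \<le> A" "exp \<bar>Re u\<bar> \<le> E" "norm s \<le> 1"
  shows "norm (a n * (exp (of_nat n * u) + s * exp (- (of_nat n * u)))) \<le> 2 * A * E ^ n"
proof -
  have "norm (exp (of_nat n * u) + s * exp (- (of_nat n * u)))
      \<le> norm (exp (of_nat n * u)) + 1 * norm (exp (of_nat n * (- u)))"
    using assms(3) by (intro order_trans[OF norm_triangle_ineq] add_left_mono)
      (simp add: norm_mult mult_right_mono)
  also have "\<dots> \<le> exp \<bar>Re u\<bar> ^ n + 1 * exp \<bar>Re (-u)\<bar> ^ n"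
    by (intro add_mono mult_left_mono norm_exp_nat_le) auto
  also have "\<dots> \<le> 2 * E ^ n"
    using power_mono[OF assms(2), of n] by simp
  finally have "norm (exp (of_nat n * u) + s * exp (- (of_nat n * u))) \<le> 2 * E ^ n" .
  with assms(1) have "norm (a n) * norm (exp (of_nat n * u) + s * exp (- (of_nat n * u))) \<le> A * (2 * E ^ n)"
    by (intro mult_mono) (auto intro: order_trans[OF norm_ge_zero])
  then show ?thesis by (simp add: norm_mult)
qed

text \<open>Near a point of the strip the terms are dominated by a fixed geometric series, so convergence is
  locally uniform and the series may be differentiated term by term.\<close>

lemma bilateral_deriv_sums:
  assumes a: "geom_growth R a" "R \<ge> 0" and s: "norm s \<le> 1" and u: "u \<in> strip R"
  shows bilateral_sums: "(\<lambda>n. a n * (exp (of_nat n * u) + s * exp (- (of_nat n * u)))) sums bilateral a s u" (is ?A)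
    and has_field_derivative_bilateral:
      "(bilateral a s has_field_derivative bilateral (\<lambda>n. of_nat n * a n) (- s) u) (at u)" (is ?B)
proof -
  have "\<exists>g g'. \<forall>x \<in> strip R.
     ((\<lambda>n. a n * (exp (of_nat n * x) + s * exp (- (of_nat n * x)))) sums g x) \<and>
     ((\<lambda>n. (of_nat n * a n) * (exp (of_nat n * x) + (- s) * exp (- (of_nat n * x)))) sums g' x) \<and>
      (g has_field_derivative g' x) (at x)"
  proof (rule series_and_derivative_comparison_complex[OF open_strip], goal_cases)
    case (1 n x)
    show ?case by (auto intro!: derivative_eq_intros simp: algebra_simps)
  next
    case (2 x)
    then obtain e where e: "e > 0" "(R + e) * exp (\<bar>Re x\<bar> + e) < 1" by (rule strip_room)
    obtain C where C: "\<And>n. norm (a n) \<le> C * (R + e) ^ n"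
      using a e unfolding geom_growth_def by (metis less_add_same_cancel1)
    have C0: "C \<ge> 0" using order_trans[OF norm_ge_zero C[of 0]] by simp
    define h where "h = (\<lambda>n. 2 * (C * (R + e) ^ n) * exp (\<bar>Re x\<bar> + e) ^ n)"
    have h_alt: "h = (\<lambda>n. (2 * C) * ((R + e) * exp (\<bar>Re x\<bar> + e)) ^ n)"
      by (auto simp: h_def power_mult_distrib)
    have "summable h" unfolding h_alt using e a(2) by (intro summable_mult summable_geometric) auto
    moreover have "h n \<ge> 0" for n using C0 a(2) e(1) by (auto simp: h_def)
    moreover have "norm (a n * (exp (of_nat n * y) + s * exp (- (of_nat n * y)))) \<le> h n"
      if "y \<in> ball x e" for n y
      unfolding h_def
    proof (rule bilateral_summand_bound[OF C _ s])
      have "\<bar>Re x - Re y\<bar> \<le> e" using that abs_Re_le_cmod[of "x - y"] by (auto simp: dist_norm)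
      then show "exp \<bar>Re y\<bar> \<le> exp (\<bar>Re x\<bar> + e)" by auto
    qed
    ultimately show ?case using e(1)
      by (intro exI[of _ e] exI[of _ "\<lambda>n. of_real (h n)"])
        (auto simp: summable_of_real image_subset_iff)
  qed
  then obtain g g' where g: "\<And>x. x \<in> strip R \<Longrightarrow>
     (\<lambda>n. a n * (exp (of_nat n * x) + s * exp (- (of_nat n * x)))) sums g x"
     "\<And>x. x \<in> strip R \<Longrightarrow> (\<lambda>n. (of_nat n * a n) * (exp (of_nat n * x) + (- s) * exp (- (of_nat n * x)))) sums g' x"
     "\<And>x. x \<in> strip R \<Longrightarrow> (g has_field_derivative g' x) (at x)" by blast
  have eq: "g x = bilateral a s x" "g' x = bilateral (\<lambda>n. of_nat n * a n) (- s) x" if "x \<in> strip R" for x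
    using g(1,2)[OF that] by (auto simp: bilateral_def sums_unique)
  show ?A using g(1)[OF u] eq[OF u] by simp
  show ?B using g(3)[OF u] unfolding eq(2)[OF u]
    by (rule has_field_derivative_transform_within_open[OF _ open_strip u]) (use eq in auto)
qed

text \<open>The same argument in the other variable: for \<open>\<bar>q\<bar> \<le> p < 1\<close> the Lambert coefficients are at most
  \<open>p^n / (1 - p)\<close>, and \<open>r > 1\<close> can be chosen with \<open>r p < 1\<close>, so subexponential weights do no harm.\<close>

lemma has_field_derivative_lambert_series:
  assumes b: "geom_growth 1 b" and q: "norm q < 1"
  shows "((\<lambda>q. \<Sum>n. b n * lambert_coeff q n) has_field_derivative (\<Sum>n. b n * (of_nat n * q ^ (n - 1) / (1 - q ^ n)\<^sup>2))) (at q)"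
    and "summable (\<lambda>n. b n * (of_nat n * q ^ (n - 1) / (1 - q ^ n)\<^sup>2))"
proof -
  have "\<exists>g g'. \<forall>x \<in> ball 0 1. ((\<lambda>n. b n * lambert_coeff x n) sums g x) \<and>
     ((\<lambda>n. b n * (of_nat n * x ^ (n - 1) / (1 - x ^ n)\<^sup>2)) sums g' x) \<and>
      (g has_field_derivative g' x) (at x)"
  proof (rule series_and_derivative_comparison_complex[OF open_ball], goal_cases)
    case (1 n x)
    show ?case
    proof (cases "n = 0")
      case True
      then show ?thesis by (simp add: lambert_coeff_def)
    next
      case False
      then have "1 - x ^ n \<noteq> 0" using 1 one_minus_power_nonzero by simp
      then show ?thesis unfolding lambert_coeff_def
        by (auto intro!: derivative_eq_intros simp: field_simps power2_eq_square)
    qed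
  next
    case (2 x)
    define p where "p = (norm x + 1) / 2"
    have p: "norm x < p" "0 < p" "p < 1" using 2 by (auto simp: p_def add_nonneg_pos)
    define r where "r = (1 + 1 / p) / 2"
    have r: "1 < r" "r * p < 1" using p by (auto simp: r_def field_simps)
    obtain C where C: "\<And>n. norm (b n) \<le> C * r ^ n"
      using b r unfolding geom_growth_def by blast
    have C0: "C \<ge> 0" using order_trans[OF norm_ge_zero C[of 0]] by simp
    define h where "h = (\<lambda>n. (C * r ^ n) * (p ^ n / (1 - p)))"
    have h_alt: "h = (\<lambda>n. (C / (1 - p)) * (r * p) ^ n)"
      by (auto simp: h_def power_mult_distrib)
    have "summable h" unfolding h_alt using p r by (intro summable_mult summable_geometric) auto
    moreover have "h n \<ge> 0" for n using C0 p r by (auto simp: h_def)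
    moreover have "norm (b n * lambert_coeff y n) \<le> h n" if "y \<in> ball x (p - norm x)" for n y
    proof -
      have y: "norm y \<le> p" using that norm_triangle_ineq2[of y x] by (auto simp: dist_norm norm_minus_commute)
      have "norm (lambert_coeff y n) \<le> norm y ^ n / (1 - norm y)" using y p by (intro norm_lambert_coeff_le) auto
      also have "\<dots> \<le> p ^ n / (1 - p)" using y p by (intro frac_le power_mono) auto
      finally show ?thesis unfolding h_def norm_mult using C C0 r by (intro mult_mono) auto
    qed
    ultimately show ?case using p
      by (intro exI[of _ "p - norm x"] exI[of _ "\<lambda>n. of_real (h n)"])
        (auto simp: summable_of_real image_subset_iff)
  qed
  then obtain g g' where g: "\<And>x. x \<in> ball 0 1 \<Longrightarrow> (\<lambda>n. b n * lambert_coeff x n) sums g x"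
     "\<And>x. x \<in> ball 0 1 \<Longrightarrow> (\<lambda>n. b n * (of_nat n * x ^ (n - 1) / (1 - x ^ n)\<^sup>2)) sums g' x"
     "\<And>x. x \<in> ball 0 1 \<Longrightarrow> (g has_field_derivative g' x) (at x)" by blast
  have q': "q \<in> ball 0 1" using q by simp
  show "summable (\<lambda>n. b n * (of_nat n * q ^ (n - 1) / (1 - q ^ n)\<^sup>2))"
    using g(2)[OF q'] by (rule sums_summable)
  show "((\<lambda>q. \<Sum>n. b n * lambert_coeff q n) has_field_derivative (\<Sum>n. b n * (of_nat n * q ^ (n - 1) / (1 - q ^ n)\<^sup>2))) (at q)"
    using g(3)[OF q'] unfolding sums_unique[OF g(2)[OF q']]
    by (rule has_field_derivative_transform_within_open[OF _ open_ball q']) (use sums_unique[OF g(1)] in auto)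
qed

section \<open>The elliptic zeta function and its addition theorem\<close>

lemma has_sum_times_complex:
  fixes f :: "'a \<Rightarrow> complex" and g :: "'b \<Rightarrow> complex"
  assumes f: "(f has_sum A) I" and g: "(g has_sum B) J"
  shows "((\<lambda>(x, y). f x * g y) has_sum (A * B)) (I \<times> J)"
proof (rule has_sum_SigmaI)
  show "((\<lambda>y. (\<lambda>(x, y). f x * g y) (x, y)) has_sum (f x * B)) J" for x
    using has_sum_cmult_right[OF g, of "f x"] by simp
  show "((\<lambda>x. f x * B) has_sum (A * B)) I" using has_sum_cmult_left[OF f, of B] by simp
  have f': "(\<lambda>x. norm (f x)) summable_on I" and g': "(\<lambda>y. norm (g y)) summable_on J"
    using f g has_sum_imp_summable summable_on_iff_abs_summable_on_complex by blast+
  have "(\<lambda>z. norm ((\<lambda>(x, y). f x * g y) z)) summable_on (I \<times> J)"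
    unfolding Infinite_Sum.abs_summable_on_Sigma_iff
  proof (intro conjI ballI)
    show "(\<lambda>y. norm ((\<lambda>(x, y). f x * g y) (x, y))) summable_on J" for x
      using g' by (simp add: norm_mult summable_on_cmult_right)
    have eq: "(\<lambda>x. norm (\<Sum>\<^sub>\<infinity>y\<in>J. norm ((\<lambda>(x, y). f x * g y) (x, y))))
        = (\<lambda>x. norm (f x) * norm (\<Sum>\<^sub>\<infinity>y\<in>J. norm (g y)))"
      by (simp add: norm_mult infsum_cmult_right' abs_mult)
    show "(\<lambda>x. norm (\<Sum>\<^sub>\<infinity>y\<in>J. norm ((\<lambda>(x, y). f x * g y) (x, y)))) summable_on I"
      unfolding eq using f' by (rule summable_on_cmult_left)
  qed
  then show "(\<lambda>(x, y). f x * g y) summable_on (I \<times> J)"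
    by (rule Infinite_Sum.abs_summable_summable)
qed

lemma has_sum_int_split:
  fixes f :: "int \<Rightarrow> complex"
  assumes p: "(p has_sum A) UNIV" and g: "(g has_sum B) UNIV"
    and f: "\<And>n. n > 0 \<Longrightarrow> f (int n) = p n" "\<And>n. n > 0 \<Longrightarrow> f (- int n) = g n" "f 0 = p 0 + g 0"
  shows "(f has_sum (A + B)) UNIV"
proof -
  have "((\<lambda>m::int. p (nat m)) has_sum A) {0..}"
    using p by (subst has_sum_reindex_bij_witness[of _ int nat UNIV p _ A]) auto
  then have 1: "((\<lambda>m::int. if m \<ge> 0 then p (nat m) else 0) has_sum A) UNIV"
    by (rule iffD1[OF has_sum_cong_neutral, rotated -1]) auto
  have "((\<lambda>m::int. g (nat (- m))) has_sum B) {..0}"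
    using g by (subst has_sum_reindex_bij_witness[of _ "\<lambda>n. - int n" "\<lambda>m. nat (- m)" UNIV g _ B]) auto
  then have 2: "((\<lambda>m::int. if m \<le> 0 then g (nat (- m)) else 0) has_sum B) UNIV"
    by (rule iffD1[OF has_sum_cong_neutral, rotated -1]) auto
  have "f m = (if m \<ge> 0 then p (nat m) else 0) + (if m \<le> 0 then g (nat (- m)) else 0)" for m
    using f(1)[of "nat m"] f(2)[of "nat (- m)"] f(3) by (cases m "0 :: int" rule: linorder_cases) auto
  then show ?thesis using has_sum_add[OF 1 2] by presburger
qed

text \<open>With \<open>z = exp u\<close>, \<open>zeta0\<close> is up to sign the logarithmic \<open>z d/dz\<close>-derivative of
  \<open>(1 - z) \<Prod> (1 - q^n z) (1 - q^n / z)\<close> shifted by \<open>1/2\<close> so as to be odd in \<open>u\<close>: the Weierstrass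
  zeta function corrected by a linear term. \<open>zeta1\<close> and \<open>zeta2\<close> are its \<open>u\<close>-derivatives.
  \<open>heat0\<close> is minus the logarithmic \<open>q d/dq\<close>-derivative of the same product, and \<open>heat1\<close>, \<open>heat2\<close>
  are its \<open>u\<close>-derivatives. Because mixed logarithmic derivatives commute, \<open>q d/dq\<close> sends
  \<open>zeta0\<close> to \<open>heat1\<close> and \<open>zeta1\<close> to \<open>heat2\<close>.\<close>

definition zeta0 where
  "zeta0 q u = (1 + exp u) / (2 * (1 - exp u)) + bilateral (lambert_coeff q) (- 1) u"
definition zeta1 where
  "zeta1 q u = exp u / (1 - exp u)\<^sup>2 + bilateral (\<lambda>n. of_nat n * lambert_coeff q n) 1 u"
definition zeta2 where
  "zeta2 q u = exp u * (1 + exp u) / (1 - exp u) ^ 3 + bilateral (\<lambda>n. of_nat n * (of_nat n * lambert_coeff q n)) (- 1) u"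
definition heat0 where "heat0 q = bilateral (lambert_coeff_sq q) 1"
definition heat1 where "heat1 q = bilateral (\<lambda>n. of_nat n * lambert_coeff_sq q n) (- 1)"
definition heat2 where "heat2 q = bilateral (\<lambda>n. of_nat n * (of_nat n * lambert_coeff_sq q n)) 1"

lemma has_field_derivative_zeta0:
  assumes "norm q < 1" "u \<in> strip (norm q)" "exp u \<noteq> 1"
  shows "(zeta0 q has_field_derivative zeta1 q u) (at u)"
proof -
  have "((\<lambda>u. (1 + exp u) / (2 * (1 - exp u))) has_field_derivative exp u / (1 - exp u)\<^sup>2) (at u)"
    using assms(3) by (auto intro!: derivative_eq_intros simp: divide_simps) (simp add: algebra_simps power2_eq_square)
  from DERIV_add[OF this has_field_derivative_bilateral[OF geom_growth_lambert[OF assms(1)] _ _ assms(2), of "- 1"]]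
  show ?thesis by (simp add: zeta0_def[abs_def] zeta1_def)
qed

lemma has_field_derivative_zeta1:
  assumes "norm q < 1" "u \<in> strip (norm q)" "exp u \<noteq> 1"
  shows "(zeta1 q has_field_derivative zeta2 q u) (at u)"
proof -
  have "((\<lambda>u. exp u / (1 - exp u)\<^sup>2) has_field_derivative exp u * (1 + exp u) / (1 - exp u) ^ 3) (at u)"
    using assms(3) by (auto intro!: derivative_eq_intros simp: divide_simps)
       (simp add: algebra_simps power2_eq_square power3_eq_cube eval_nat_numeral)
  from DERIV_add[OF this has_field_derivative_bilateral[OF geom_growth_mult_n[OF geom_growth_lambert[OF assms(1)]] _ _ assms(2), of 1]]
  show ?thesis by (simp add: zeta1_def[abs_def] zeta2_def)
qed

lemma has_field_derivative_heat0:
  assumes "norm q < 1" "u \<in> strip (norm q)"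
  shows "(heat0 q has_field_derivative heat1 q u) (at u)"
  using has_field_derivative_bilateral[OF geom_growth_lambert_sq[OF assms(1)] _ _ assms(2), of 1]
  by (simp add: heat0_def heat1_def)

lemma has_field_derivative_heat1:
  assumes "norm q < 1" "u \<in> strip (norm q)"
  shows "(heat1 q has_field_derivative heat2 q u) (at u)"
  using has_field_derivative_bilateral[OF geom_growth_mult_n[OF geom_growth_lambert_sq[OF assms(1)]] _ _ assms(2), of "-1"]
  by (simp add: heat1_def heat2_def)

text \<open>The Laurent coefficients of \<open>zeta0\<close> and \<open>heat0\<close> in the annulus \<open>\<bar>q\<bar> < \<bar>z\<bar> < 1\<close>. There the
  rational term of \<open>zeta0\<close> expands into \<open>1/2 + z + z\<^sup>2 + \<dots>\<close>, and adding \<open>1\<close> to \<open>q^n / (1 - q^n)\<close> gives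
  \<open>1 / (1 - q^n)\<close>, an expression valid for both signs of \<open>n\<close>.\<close>

definition zeta_coeff :: "complex \<Rightarrow> int \<Rightarrow> complex" where
  "zeta_coeff q m = (if m = 0 then 1 / 2 else 1 / (1 - q powi m))"
definition heat_coeff :: "complex \<Rightarrow> int \<Rightarrow> complex" where
  "heat_coeff q m = (if m = 0 then 0 else q powi m / (1 - q powi m)\<^sup>2)"

lemma bilateral_half_has_sum:
  assumes "geom_growth R a" "R \<ge> 0" "u \<in> strip R"
  shows "((\<lambda>n. a n * exp (of_nat n * u)) has_sum bilateral a 0 u) UNIV"
  using norm_summable_imp_has_sum[OF bilateral_summable_norm[OF assms] bilateral_sums[OF assms(1,2) _ assms(3), of 0, simplified]] .

lemma uminus_in_strip [simp]: "- u \<in> strip R \<longleftrightarrow> u \<in> strip R"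
  by (simp add: strip_def)

lemma bilateral_eq_halves:
  assumes "geom_growth R a" "R \<ge> 0" "u \<in> strip R" "norm s \<le> 1"
  shows "bilateral a s u = bilateral a 0 u + s * bilateral a 0 (- u)"
proof -
  have "(\<lambda>n. a n * exp (of_nat n * u) + s * (a n * exp (of_nat n * (- u)))) sums (bilateral a 0 u + s * bilateral a 0 (- u))"
    using bilateral_sums[OF assms(1,2) _ assms(3), of 0] bilateral_sums[OF assms(1,2) _, of 0 "- u"] assms
    by (intro sums_add sums_mult) auto
  then show ?thesis using bilateral_sums[OF assms(1,2,4,3)] by (simp add: algebra_simps sums_iff)
qed

lemma zeta0_has_sum:
  assumes q: "norm q < 1" "q \<noteq> 0" and u: "u \<in> strip (norm q)" "Re u < 0"
  shows "((\<lambda>m. zeta_coeff q m * exp (of_int m * u)) has_sum zeta0 q u) UNIV"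
proof -
  note gg = geom_growth_lambert[OF q(1)]
  have nz: "exp u \<noteq> 1" using u(2) by (metis norm_exp_eq_Re exp_less_one_iff norm_one less_irrefl)
  have n1: "norm (exp u) < 1" using u by simp
  have "((\<lambda>n. exp u ^ n) has_sum (1 / (1 - exp u))) UNIV"
    using geometric_sums[OF n1] n1 by (intro norm_summable_imp_has_sum) (auto simp: norm_power summable_geometric)
  moreover have "((\<lambda>n::nat. if n = 0 then - 1 / 2 else 0 :: complex) has_sum (- 1 / 2)) UNIV"
    using has_sum_finite_neutralI[of "{0::nat}" UNIV "\<lambda>n. if n = 0 then - 1 / 2 else 0 :: complex"] by simp
  ultimately have "((\<lambda>n. exp u ^ n + (if n = 0 then - 1 / 2 else 0) + lambert_coeff q n * exp (of_nat n * u)) has_sum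
     (1 / (1 - exp u) + (- 1 / 2) + bilateral (lambert_coeff q) 0 u)) UNIV"
    by (intro has_sum_add bilateral_half_has_sum[OF gg _ u(1)]) auto
  moreover have "((\<lambda>n. (- 1) * (lambert_coeff q n * exp (of_nat n * (- u)))) has_sum ((- 1) * bilateral (lambert_coeff q) 0 (- u))) UNIV"
    using u by (intro has_sum_cmult_right bilateral_half_has_sum[OF gg]) auto
  ultimately have "((\<lambda>m. zeta_coeff q m * exp (of_int m * u)) has_sum
     (1 / (1 - exp u) + (- 1 / 2) + bilateral (lambert_coeff q) 0 u + (- 1) * bilateral (lambert_coeff q) 0 (- u))) UNIV"
  proof (rule has_sum_int_split)
    fix n :: nat assume n: "n > 0"
    have nz: "1 - q ^ n \<noteq> 0" using one_minus_power_nonzero[OF q(1) n] .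
    show "zeta_coeff q (int n) * exp (of_int (int n) * u) = exp u ^ n + (if n = 0 then - 1 / 2 else 0) + lambert_coeff q n * exp (of_nat n * u)"
      using n nz by (simp add: zeta_coeff_def lambert_coeff_def field_simps exp_of_nat_mult[symmetric])
    have "1 - inverse (q ^ n) \<noteq> 0" using nz q(2) by (auto simp: field_simps)
    then show "zeta_coeff q (- int n) * exp (of_int (- int n) * u) = - 1 * (lambert_coeff q n * exp (of_nat n * - u))"
      using n nz q(2) by (simp add: zeta_coeff_def lambert_coeff_def power_int_minus field_simps)
  qed (simp add: zeta_coeff_def lambert_coeff_def)
  also have "1 / (1 - exp u) + (- 1 / 2) + bilateral (lambert_coeff q) 0 u + (- 1) * bilateral (lambert_coeff q) 0 (- u) = zeta0 q u"
  proof -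
    have c: "1 / (1 - exp u) + (- 1 / 2) = (1 + exp u) / (2 * (1 - exp u))"
      using nz by (simp add: divide_simps)
    show ?thesis unfolding c zeta0_def using bilateral_eq_halves[OF gg _ u(1), of "- 1"] by simp
  qed
  finally show ?thesis .
qed

lemma heat0_has_sum:
  assumes q: "norm q < 1" "q \<noteq> 0" and u: "u \<in> strip (norm q)"
  shows "((\<lambda>m. heat_coeff q m * exp (of_int m * u)) has_sum heat0 q u) UNIV"
proof -
  note gg = geom_growth_lambert_sq[OF q(1)]
  have "((\<lambda>m. heat_coeff q m * exp (of_int m * u)) has_sum (bilateral (lambert_coeff_sq q) 0 u + bilateral (lambert_coeff_sq q) 0 (- u))) UNIV"
  proof (rule has_sum_int_split[OF bilateral_half_has_sum[OF gg _ u] bilateral_half_has_sum[OF gg]])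
    fix n :: nat assume n: "n > 0"
    have nz: "1 - q ^ n \<noteq> 0" using one_minus_power_nonzero[OF q(1) n] .
    show "heat_coeff q (int n) * exp (of_int (int n) * u) = lambert_coeff_sq q n * exp (of_nat n * u)"
      using n nz by (simp add: heat_coeff_def lambert_coeff_sq_def)
    have "1 - inverse (q ^ n) \<noteq> 0" using nz q(2) by (auto simp: field_simps)
    then have "q powi (- int n) / (1 - q powi (- int n))\<^sup>2 = q ^ n / (1 - q ^ n)\<^sup>2"
      using nz q(2) by (simp add: power_int_minus divide_simps) (simp add: algebra_simps power2_eq_square)
    then show "heat_coeff q (- int n) * exp (of_int (- int n) * u) = lambert_coeff_sq q n * exp (of_nat n * - u)"
      using n by (simp add: heat_coeff_def lambert_coeff_sq_def)
  qed (use u in \<open>simp_all add: heat_coeff_def lambert_coeff_sq_def\<close>)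
  also have "bilateral (lambert_coeff_sq q) 0 u + bilateral (lambert_coeff_sq q) 0 (- u) = heat0 q u"
    using bilateral_eq_halves[OF gg _ u, of 1] by (simp add: heat0_def)
  finally show ?thesis .
qed

lemma power_int_eq_1_iff_norm_less_1:
  assumes q: "norm (q::complex) < 1" "q \<noteq> 0"
  shows "q powi m = 1 \<longleftrightarrow> m = 0"
proof
  assume *: "q powi m = 1"
  show "m = 0"
  proof (rule ccontr)
    assume "m \<noteq> 0"
    moreover have "q ^ nat \<bar>m\<bar> = 1" using * q(2)
      by (cases "m \<ge> 0") (auto simp: power_int_def inverse_eq_1_iff power_inverse)
    ultimately show False using one_minus_power_nonzero[OF q(1), of "nat \<bar>m\<bar>"] by simp
  qed
qed auto

lemma zeta_coeff_minus:
  assumes q: "norm q < 1" "q \<noteq> 0" and n: "n \<noteq> 0"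
  shows "zeta_coeff q (- n) = 1 - zeta_coeff q n" "heat_coeff q n = zeta_coeff q n * zeta_coeff q n - zeta_coeff q n"
proof -
  define b where "b = q powi n"
  have b: "b \<noteq> 0" "b \<noteq> 1" using q n power_int_eq_1_iff_norm_less_1[OF q] by (auto simp: b_def)
  then show "heat_coeff q n = zeta_coeff q n * zeta_coeff q n - zeta_coeff q n"
    using n by (simp add: zeta_coeff_def heat_coeff_def b_def[symmetric] divide_simps) (simp add: algebra_simps power2_eq_square)
  have e: "q powi (- n) = 1 / b" by (simp add: b_def power_int_minus field_simps)
  show "zeta_coeff q (- n) = 1 - zeta_coeff q n"
    using n b unfolding zeta_coeff_def e b_def[symmetric] by (simp add: divide_simps) (simp add: algebra_simps)
qed

text \<open>The addition theorem coefficient by coefficient. For \<open>m\<close>, \<open>n\<close>, \<open>m - n\<close> all nonzero the left side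
  vanishes by a partial fraction identity for \<open>a = q^m\<close> and \<open>b = q^n\<close>; only the three lines
  \<open>m = 0\<close>, \<open>n = 0\<close>, \<open>m = n\<close> survive, and they are the series for \<open>heat0\<close>.\<close>

lemma addition_coeff:
  assumes q: "norm q < 1" "q \<noteq> 0"
  shows "zeta_coeff q m * zeta_coeff q n - zeta_coeff q n * zeta_coeff q (m - n) - zeta_coeff q m * zeta_coeff q (n - m) =
     heat_coeff q m * of_bool (n = 0) + of_bool (m = 0) * heat_coeff q n + heat_coeff q m * of_bool (n - m = 0)
       - 1 / 4 * (of_bool (m = 0) * of_bool (n = 0))"
proof -
  have c0: "zeta_coeff q 0 = 1 / 2" "heat_coeff q 0 = 0" by (simp_all add: zeta_coeff_def heat_coeff_def)
  consider "m = 0" "n = 0" | "m = 0" "n \<noteq> 0" | "m \<noteq> 0" "n = 0" | "m \<noteq> 0" "m = n" | "m \<noteq> 0" "n \<noteq> 0" "m \<noteq> n" by blast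
  then show ?thesis
  proof cases
    case 5
    define a b where "a = q powi m" and "b = q powi n"
    have ab: "a \<noteq> 0" "b \<noteq> 0" "a \<noteq> 1" "b \<noteq> 1" and d: "q powi (m - n) = a / b"
      using q 5 power_int_eq_1_iff_norm_less_1[OF q] by (auto simp: a_def b_def power_int_diff)
    have "a \<noteq> b" using d ab 5 power_int_eq_1_iff_norm_less_1[OF q, of "m - n"] by auto
    then have "zeta_coeff q m * zeta_coeff q n = zeta_coeff q n * zeta_coeff q (m - n) + zeta_coeff q m * (1 - zeta_coeff q (m - n))"
      using 5 ab unfolding zeta_coeff_def d a_def[symmetric] b_def[symmetric]
      by (simp add: divide_simps) (simp add: algebra_simps)
    moreover have "zeta_coeff q (n - m) = 1 - zeta_coeff q (m - n)" using 5 zeta_coeff_minus(1)[OF q, of "m - n"] by simp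
    ultimately show ?thesis using 5 by simp
  qed (simp_all add: c0 zeta_coeff_minus[OF q] right_diff_distrib)
qed

text \<open>Together with \<open>zeta_riccati\<close> below this is the classical identity, for \<open>u + v + w = 0\<close>,
  \<open>(\<zeta>(u) + \<zeta>(v) + \<zeta>(w))\<^sup>2 = \<wp>(u) + \<wp>(v) + \<wp>(w)\<close>. Inside the annulus every factor is an
  absolutely convergent Laurent series, so the products are double series over pairs \<open>(m, n)\<close>;
  putting all of them on the monomials \<open>exp (m u + n v)\<close> reduces the claim to \<open>addition_coeff\<close>.\<close>

lemma zeta_addition_inside:
  assumes q: "norm q < 1" "q \<noteq> 0" and u: "u \<in> strip (norm q)" "Re u < 0"
    and v: "v \<in> strip (norm q)" "Re v < 0" and uv: "u + v \<in> strip (norm q)"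
  shows "zeta0 q u * zeta0 q v - zeta0 q (u + v) * zeta0 q u - zeta0 q (u + v) * zeta0 q v =
     heat0 q u + heat0 q v + heat0 q (u + v) - 1 / 4"
proof -
  define E where "E = (\<lambda>(m::int, n::int). exp (of_int m * u) * exp (of_int n * v))"
  have Re_uv: "Re (u + v) < 0" using u v by simp
  note zu = zeta0_has_sum[OF q u] and zv = zeta0_has_sum[OF q v] and zuv = zeta0_has_sum[OF q uv Re_uv]
  note hu = heat0_has_sum[OF q u(1)] and hv = heat0_has_sum[OF q v(1)] and huv = heat0_has_sum[OF q uv]
  have delta: "((\<lambda>m::int. of_bool (m = 0) :: complex) has_sum 1) UNIV"
    using has_sum_finite_neutralI[of "{0::int}" UNIV "\<lambda>m. of_bool (m = 0) :: complex"] by simp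
  have 1: "((\<lambda>(m, n). zeta_coeff q m * zeta_coeff q n * E (m, n)) has_sum (zeta0 q u * zeta0 q v)) UNIV"
    using has_sum_times_complex[OF zu zv] by (simp add: E_def case_prod_unfold mult_ac)
  have 2: "((\<lambda>(m, n). zeta_coeff q n * zeta_coeff q (m - n) * E (m, n)) has_sum (zeta0 q (u + v) * zeta0 q u)) UNIV"
    using has_sum_times_complex[OF zuv zu]
    by (subst has_sum_reindex_bij_witness[of _ "\<lambda>(a, b). (a + b, a)" "\<lambda>(m, n). (n, m - n)" UNIV
          "\<lambda>(a, b). zeta_coeff q a * exp (of_int a * (u + v)) * (zeta_coeff q b * exp (of_int b * u))"])
       (auto simp: E_def algebra_simps simp flip: exp_add)
  have 3: "((\<lambda>(m, n). zeta_coeff q m * zeta_coeff q (n - m) * E (m, n)) has_sum (zeta0 q (u + v) * zeta0 q v)) UNIV"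
    using has_sum_times_complex[OF zuv zv]
    by (subst has_sum_reindex_bij_witness[of _ "\<lambda>(a, b). (a, a + b)" "\<lambda>(m, n). (m, n - m)" UNIV
          "\<lambda>(a, b). zeta_coeff q a * exp (of_int a * (u + v)) * (zeta_coeff q b * exp (of_int b * v))"])
       (auto simp: E_def algebra_simps simp flip: exp_add)
  have 4: "((\<lambda>(m, n). heat_coeff q m * of_bool (n = 0) * E (m, n)) has_sum (heat0 q u * 1)) UNIV"
    using has_sum_times_complex[OF hu delta] unfolding UNIV_Times_UNIV
    by (rule iffD1[OF has_sum_cong, rotated -1]) (auto simp: E_def)
  have 5: "((\<lambda>(m, n). of_bool (m = 0) * heat_coeff q n * E (m, n)) has_sum (1 * heat0 q v)) UNIV"
    using has_sum_times_complex[OF delta hv] unfolding UNIV_Times_UNIV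
    by (rule iffD1[OF has_sum_cong, rotated -1]) (auto simp: E_def)
  have 6: "((\<lambda>(m, n). heat_coeff q m * of_bool (n - m = 0) * E (m, n)) has_sum (heat0 q (u + v) * 1)) UNIV"
    using has_sum_times_complex[OF huv delta]
    by (subst has_sum_reindex_bij_witness[of _ "\<lambda>(a, b). (a, a + b)" "\<lambda>(m, n). (m, n - m)" UNIV
          "\<lambda>(a, b). heat_coeff q a * exp (of_int a * (u + v)) * of_bool (b = 0)"])
       (auto simp: E_def algebra_simps simp flip: exp_add)
  have 7: "((\<lambda>(m, n). of_bool (m = 0) * of_bool (n = 0) * E (m, n)) has_sum (1 * 1)) UNIV"
    using has_sum_times_complex[OF delta delta] unfolding UNIV_Times_UNIV
    by (rule iffD1[OF has_sum_cong, rotated -1]) (auto simp: E_def)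
  have "((\<lambda>(m, n). (zeta_coeff q m * zeta_coeff q n - zeta_coeff q n * zeta_coeff q (m - n) - zeta_coeff q m * zeta_coeff q (n - m)) * E (m, n)) has_sum
      (zeta0 q u * zeta0 q v + - (zeta0 q (u + v) * zeta0 q u) + - (zeta0 q (u + v) * zeta0 q v))) UNIV"
    using has_sum_add[OF has_sum_add[OF 1 has_sum_cmult_right[OF 2, of "- 1"]] has_sum_cmult_right[OF 3, of "- 1"]]
    by (simp add: case_prod_unfold algebra_simps)
  moreover have "((\<lambda>(m, n). (heat_coeff q m * of_bool (n = 0) + of_bool (m = 0) * heat_coeff q n + heat_coeff q m * of_bool (n - m = 0)
       - 1 / 4 * (of_bool (m = 0) * of_bool (n = 0))) * E (m, n)) has_sum
      (heat0 q u * 1 + 1 * heat0 q v + heat0 q (u + v) * 1 + (- 1 / 4) * (1 * 1))) UNIV"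
    using has_sum_add[OF has_sum_add[OF has_sum_add[OF 4 5] 6] has_sum_cmult_right[OF 7, of "- 1 / 4"]]
    by (simp add: case_prod_unfold algebra_simps)
  ultimately show ?thesis unfolding addition_coeff[OF q]
    by (auto dest: has_sum_unique)
qed

section \<open>Derivatives of the addition theorem on the imaginary axis\<close>

lemma limits_eq_of_eventually_eq:
  fixes a b :: "'b::t2_space"
  assumes "\<forall>\<^sub>F x in F. f x = g x" "(f \<longlongrightarrow> a) F" "(g \<longlongrightarrow> b) F" "F \<noteq> bot"
  shows "a = b"
  using tendsto_unique[OF assms(4) assms(2)] assms(3) tendsto_cong[OF assms(1)] by blast

lemma imaginary_in_strip: "Re u = 0 \<Longrightarrow> R < 1 \<Longrightarrow> u \<in> strip R"
  by (simp add: strip_def)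

lemma isCont_zeta0: "norm q < 1 \<Longrightarrow> u \<in> strip (norm q) \<Longrightarrow> exp u \<noteq> 1 \<Longrightarrow> isCont (zeta0 q) u"
  using has_field_derivative_zeta0 DERIV_isCont by blast

lemma isCont_heat0: "norm q < 1 \<Longrightarrow> u \<in> strip (norm q) \<Longrightarrow> isCont (heat0 q) u"
  using has_field_derivative_heat0 DERIV_isCont by blast

text \<open>The points of finite order lie on the imaginary axis, the boundary of the region where the Laurent
  series of \<open>zeta0\<close> converges. Both sides are continuous there, so the identity is obtained by
  letting \<open>r\<close> tend to \<open>0\<close> in \<open>u - r\<close> and \<open>v - r\<close>.\<close>

lemma zeta_addition:
  assumes q: "norm q < 1" "q \<noteq> 0" and u: "Re u = 0" "exp u \<noteq> 1"
    and v: "Re v = 0" "exp v \<noteq> 1" and uv: "exp (u + v) \<noteq> 1"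
  shows "zeta0 q u * zeta0 q v - zeta0 q (u + v) * zeta0 q u - zeta0 q (u + v) * zeta0 q v =
     heat0 q u + heat0 q v + heat0 q (u + v) - 1 / 4"
proof -
  define U V W where "U = (\<lambda>r::real. u - of_real r)" and "V = (\<lambda>r::real. v - of_real r)"
    and "W = (\<lambda>r. U r + V r)"
  have lim: "(U \<longlongrightarrow> u) (at_right 0)" "(V \<longlongrightarrow> v) (at_right 0)" "(W \<longlongrightarrow> u + v) (at_right 0)"
    unfolding U_def V_def W_def by (auto intro!: tendsto_eq_intros)
  have s: "u \<in> strip (norm q)" "v \<in> strip (norm q)" "u + v \<in> strip (norm q)"
    using u v q by (auto intro!: imaginary_in_strip)
  note st = topological_tendstoD[OF lim(1) open_strip s(1)]
    topological_tendstoD[OF lim(2) open_strip s(2)] topological_tendstoD[OF lim(3) open_strip s(3)]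
  have "\<forall>\<^sub>F r in at_right 0. zeta0 q (U r) * zeta0 q (V r) - zeta0 q (W r) * zeta0 q (U r) - zeta0 q (W r) * zeta0 q (V r) =
     heat0 q (U r) + heat0 q (V r) + heat0 q (W r) - 1 / 4"
    using st eventually_at_right_less[of "0::real"]
  proof eventually_elim
    case (elim r)
    then show ?case unfolding W_def
      by (intro zeta_addition_inside[OF q]) (auto simp: U_def V_def u v)
  qed
  moreover have "((\<lambda>r. zeta0 q (U r) * zeta0 q (V r) - zeta0 q (W r) * zeta0 q (U r) - zeta0 q (W r) * zeta0 q (V r))
     \<longlongrightarrow> zeta0 q u * zeta0 q v - zeta0 q (u + v) * zeta0 q u - zeta0 q (u + v) * zeta0 q v) (at_right 0)"
    using u v uv s q
    by (intro tendsto_intros isCont_tendsto_compose[OF isCont_zeta0] lim) auto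
  moreover have "((\<lambda>r. heat0 q (U r) + heat0 q (V r) + heat0 q (W r) - 1 / 4)
     \<longlongrightarrow> heat0 q u + heat0 q v + heat0 q (u + v) - 1 / 4) (at_right 0)"
    using s q by (intro tendsto_intros isCont_tendsto_compose[OF isCont_heat0] lim) auto
  ultimately show ?thesis
    by (rule limits_eq_of_eventually_eq) simp
qed

text \<open>A complex derivative can be computed along any direction; hence an identity known on the imaginary
  axis only may be differentiated there.\<close>

lemma derivative_zero_of_imaginary:
  assumes F: "(F has_field_derivative D) (at (u::complex))"
    and ev: "\<forall>\<^sub>F t in at (0::real). F (u + \<i> * of_real t) = 0" and "F u = 0"
  shows "D = 0"
proof -
  have "filterlim (\<lambda>t. \<i> * complex_of_real t) (at 0) (at (0::real))"
    unfolding filterlim_at by (auto intro!: tendsto_eq_intros simp: eventually_at_filter)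
  from filterlim_compose[OF F[unfolded DERIV_def] this]
  have "((\<lambda>t. (F (u + \<i> * of_real t) - F u) / (\<i> * of_real t)) \<longlongrightarrow> D) (at (0::real))" .
  moreover have "((\<lambda>t. (F (u + \<i> * of_real t) - F u) / (\<i> * of_real t)) \<longlongrightarrow> 0) (at (0::real))"
    using ev by (intro tendsto_eventually, eventually_elim) (simp add: assms(3))
  ultimately show ?thesis using tendsto_unique[OF at_neq_bot] by blast
qed

lemma eventually_exp_imaginary_neq_1:
  assumes "exp u \<noteq> 1"
  shows "\<forall>\<^sub>F t in at (0::real). exp (u + \<i> * of_real t) \<noteq> 1"
proof -
  have "((\<lambda>t. exp (u + \<i> * of_real t)) \<longlongrightarrow> exp u) (at (0::real))"
    by (auto intro!: tendsto_eq_intros)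
  then show ?thesis using assms by (rule tendsto_imp_eventually_ne)
qed

lemma zeta_addition_deriv:
  assumes q: "norm q < 1" "q \<noteq> 0" and u: "Re u = 0" "exp u \<noteq> 1"
    and v: "Re v = 0" "exp v \<noteq> 1" and uv: "exp (u + v) \<noteq> 1"
  shows "zeta1 q u * zeta0 q v - zeta1 q (u + v) * (zeta0 q u + zeta0 q v) - zeta0 q (u + v) * zeta1 q u =
     heat1 q u + heat1 q (u + v)"
proof -
  have s: "u \<in> strip (norm q)" "v \<in> strip (norm q)" "u + v \<in> strip (norm q)"
    using u v q by (auto intro!: imaginary_in_strip)
  define F where "F = (\<lambda>x. zeta0 q x * zeta0 q v - zeta0 q (x + v) * zeta0 q x - zeta0 q (x + v) * zeta0 q v
     - (heat0 q x + heat0 q v + heat0 q (x + v) - 1 / 4))"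
  have "((\<lambda>x. zeta0 q (x + v)) has_field_derivative zeta1 q (u + v)) (at u)"
    using has_field_derivative_zeta0[OF q(1) s(3) uv] by (simp add: DERIV_shift)
  moreover have "((\<lambda>x. heat0 q (x + v)) has_field_derivative heat1 q (u + v)) (at u)"
    using has_field_derivative_heat0[OF q(1) s(3)] by (simp add: DERIV_shift)
  ultimately have "(F has_field_derivative
     (zeta1 q u * zeta0 q v - zeta1 q (u + v) * (zeta0 q u + zeta0 q v) - zeta0 q (u + v) * zeta1 q u
       - (heat1 q u + heat1 q (u + v)))) (at u)"
    unfolding F_def using has_field_derivative_zeta0[OF q(1) s(1) u(2)] has_field_derivative_heat0[OF q(1) s(1)]
    by (auto intro!: derivative_eq_intros simp: algebra_simps)
  moreover have "F u = 0" using zeta_addition[OF q u v uv] by (simp add: F_def)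
  moreover have "\<forall>\<^sub>F t in at 0. F (u + \<i> * complex_of_real t) = 0"
    using eventually_exp_imaginary_neq_1[OF u(2)] eventually_exp_imaginary_neq_1[OF uv]
  proof eventually_elim
    case (elim t)
    then show ?case using zeta_addition[OF q _ _ v, of "u + \<i> * complex_of_real t"] u(1)
      by (simp add: F_def add_ac)
  qed
  ultimately have "zeta1 q u * zeta0 q v - zeta1 q (u + v) * (zeta0 q u + zeta0 q v) - zeta0 q (u + v) * zeta1 q u
       - (heat1 q u + heat1 q (u + v)) = 0" using derivative_zero_of_imaginary by blast
  then show ?thesis by simp
qed

lemma zeta_addition_deriv2:
  assumes q: "norm q < 1" "q \<noteq> 0" and u: "Re u = 0" "exp u \<noteq> 1"
    and v: "Re v = 0" "exp v \<noteq> 1" and uv: "exp (u + v) \<noteq> 1"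
  shows "zeta1 q u * zeta1 q v - zeta2 q (u + v) * (zeta0 q u + zeta0 q v)
     - zeta1 q (u + v) * (zeta1 q u + zeta1 q v) = heat2 q (u + v)"
proof -
  have s: "u \<in> strip (norm q)" "v \<in> strip (norm q)" "u + v \<in> strip (norm q)"
    using u v q by (auto intro!: imaginary_in_strip)
  define F where "F = (\<lambda>x. zeta1 q u * zeta0 q x - zeta1 q (x + u) * (zeta0 q u + zeta0 q x) - zeta0 q (x + u) * zeta1 q u
     - (heat1 q u + heat1 q (x + u)))"
  have "((\<lambda>x. zeta0 q (x + u)) has_field_derivative zeta1 q (u + v)) (at v)"
    using has_field_derivative_zeta0[OF q(1) s(3) uv] by (simp add: DERIV_shift[symmetric] add.commute[of v u])
  moreover have "((\<lambda>x. zeta1 q (x + u)) has_field_derivative zeta2 q (u + v)) (at v)"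
    using has_field_derivative_zeta1[OF q(1) s(3) uv] by (simp add: DERIV_shift[symmetric] add.commute[of v u])
  moreover have "((\<lambda>x. heat1 q (x + u)) has_field_derivative heat2 q (u + v)) (at v)"
    using has_field_derivative_heat1[OF q(1) s(3)] by (simp add: DERIV_shift[symmetric] add.commute[of v u])
  ultimately have "(F has_field_derivative
     (zeta1 q u * zeta1 q v - zeta2 q (u + v) * (zeta0 q u + zeta0 q v)
     - zeta1 q (u + v) * (zeta1 q u + zeta1 q v) - heat2 q (u + v))) (at v)"
    unfolding F_def using has_field_derivative_zeta0[OF q(1) s(2) v(2)]
    by (auto intro!: derivative_eq_intros simp: algebra_simps)
  moreover have "F v = 0" using zeta_addition_deriv[OF q u v uv] by (simp add: F_def add.commute)
  moreover have "\<forall>\<^sub>F t in at 0. F (v + \<i> * complex_of_real t) = 0"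
    using eventually_exp_imaginary_neq_1[OF v(2)] eventually_exp_imaginary_neq_1[OF uv]
  proof eventually_elim
    case (elim t)
    then show ?case using zeta_addition_deriv[OF q u, of "v + \<i> * complex_of_real t"] v(1)
      by (simp add: F_def add_ac)
  qed
  ultimately have "zeta1 q u * zeta1 q v - zeta2 q (u + v) * (zeta0 q u + zeta0 q v)
     - zeta1 q (u + v) * (zeta1 q u + zeta1 q v) - heat2 q (u + v) = 0"
    using derivative_zero_of_imaginary by blast
  then show ?thesis by simp
qed

text \<open>The limit \<open>v \<rightarrow> 0\<close> of the addition theorem: \<open>zeta0\<close> has a pole \<open>- 1 / v\<close>, which turns
  \<open>zeta0 q u - zeta0 q (u + v)\<close> into the derivative \<open>zeta1 q u\<close>. The result is the heat equation of
  the theta function in logarithmic form.\<close>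

lemma zeta_riccati:
  assumes q: "norm q < 1" "q \<noteq> 0" and u: "Re u = 0" "exp u \<noteq> 1"
  shows "zeta1 q u = (zeta0 q u)\<^sup>2 + 2 * heat0 q u + heat0 q 0 - 1 / 4"
proof -
  have s: "u \<in> strip (norm q)" "0 \<in> strip (norm q)" using u q by (auto intro!: imaginary_in_strip)
  define V where "V = (\<lambda>t::real. \<i> * complex_of_real t)"
  have V0: "(V \<longlongrightarrow> 0) (at 0)" unfolding V_def by (auto intro!: tendsto_eq_intros)
  have V: "filterlim V (at 0) (at (0::real))"
    unfolding filterlim_at using V0 by (auto simp: eventually_at_filter V_def)
  \<comment> \<open>the factor \<open>(exp v - 1) / v\<close> tends to 1, and \<open>zeta0\<close> behaves like \<open>1 / (1 - exp v)\<close>\<close>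
  have pole: "((\<lambda>v. v * zeta0 q v) \<longlongrightarrow> -1) (at 0)"
  proof -
    have "((\<lambda>v. (exp (0 + v) - exp 0) / v) \<longlongrightarrow> exp 0) (at (0::complex))"
      using DERIV_exp unfolding DERIV_def by fast
    then have "((\<lambda>v. (1 + exp v) / (- 2 * ((exp (0 + v) - exp 0) / v)) + v * bilateral (lambert_coeff q) (-1) v)
        \<longlongrightarrow> (1 + exp 0) / (- 2 * exp 0) + 0 * bilateral (lambert_coeff q) (-1) 0) (at 0)"
      using has_field_derivative_bilateral[OF geom_growth_lambert[OF q(1)] _ _ s(2), of "-1"]
      by (intro tendsto_intros) (auto simp: isCont_def dest!: DERIV_isCont)
    moreover have "\<forall>\<^sub>F v in at 0. (1 + exp v) / (- 2 * ((exp (0 + v) - exp 0) / v)) + v * bilateral (lambert_coeff q) (-1) v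
       = v * zeta0 q v"
    proof -
      have "(1 + exp v) / (- 2 * ((exp (0 + v) - exp 0) / v)) = v * ((1 + exp v) / (2 * (1 - exp v)))"
        if "v \<noteq> 0" for v :: complex using that
        by (cases "exp v = 1") (auto simp: divide_simps)
      then show ?thesis by (auto simp: eventually_at_filter zeta0_def algebra_simps)
    qed
    ultimately show ?thesis by (auto elim: Lim_transform_eventually)
  qed
  have quot: "((\<lambda>v. (zeta0 q (u + v) - zeta0 q u) / v) \<longlongrightarrow> zeta1 q u) (at 0)"
    using has_field_derivative_zeta0[OF q(1) s(1) u(2)] unfolding DERIV_def .
  have "((\<lambda>t. (V t * zeta0 q (V t)) * (- ((zeta0 q (u + V t) - zeta0 q u) / V t)) - zeta0 q (u + V t) * zeta0 q u)
       \<longlongrightarrow> (- 1) * (- zeta1 q u) - zeta0 q (u + 0) * zeta0 q u) (at 0)"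
    using q s u by (intro tendsto_intros filterlim_compose[OF pole V] filterlim_compose[OF quot V]
       isCont_tendsto_compose[OF isCont_zeta0] V0) auto
  moreover have "((\<lambda>t. heat0 q u + heat0 q (V t) + heat0 q (u + V t) - 1 / 4)
       \<longlongrightarrow> heat0 q u + heat0 q 0 + heat0 q (u + 0) - 1 / 4) (at 0)"
    using q s u by (intro tendsto_intros isCont_tendsto_compose[OF isCont_heat0] V0) auto
  moreover have "\<forall>\<^sub>F t in at 0. (V t * zeta0 q (V t)) * (- ((zeta0 q (u + V t) - zeta0 q u) / V t)) - zeta0 q (u + V t) * zeta0 q u
     = heat0 q u + heat0 q (V t) + heat0 q (u + V t) - 1 / 4"
  proof -
    have "\<forall>\<^sub>F t in at 0. exp (V t) \<noteq> 1"
      unfolding V_def eventually_at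
    proof (intro exI[of _ 1] conjI ballI impI)
      fix t :: real assume t: "t \<noteq> 0 \<and> dist t 0 < 1"
      show "exp (\<i> * complex_of_real t) \<noteq> 1"
      proof
        assume "exp (\<i> * complex_of_real t) = 1"
        then obtain n :: int where n: "t = of_int (2 * n) * pi" by (auto simp: exp_eq_1)
        then have "n \<noteq> 0" using t by auto
        then have "\<bar>t\<bar> \<ge> 2 * pi" unfolding n by (auto simp: abs_mult)
        then show False using t pi_gt3 by auto
      qed
    qed simp
    with eventually_exp_imaginary_neq_1[OF u(2)] eventually_neq_at_within[of 0 0 UNIV]
    show ?thesis
    proof eventually_elim
      case (elim t)
      then have "V t \<noteq> 0" by (auto simp: V_def)
      then have "(V t * zeta0 q (V t)) * (- ((zeta0 q (u + V t) - zeta0 q u) / V t)) - zeta0 q (u + V t) * zeta0 q u =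
        zeta0 q u * zeta0 q (V t) - zeta0 q (u + V t) * zeta0 q u - zeta0 q (u + V t) * zeta0 q (V t)"
        by (simp add: field_simps)
      also have "\<dots> = heat0 q u + heat0 q (V t) + heat0 q (u + V t) - 1 / 4"
        by (intro zeta_addition[OF q u]) (use elim in \<open>auto simp: V_def\<close>)
      finally show ?case .
    qed
  qed
  ultimately have "(- 1) * (- zeta1 q u) - zeta0 q (u + 0) * zeta0 q u = heat0 q u + heat0 q 0 + heat0 q (u + 0) - 1 / 4"
    by (intro limits_eq_of_eventually_eq[where F = "at (0::real)"]) auto
  then show ?thesis by (simp add: power2_eq_square algebra_simps)
qed

section \<open>Values at the points of order six\<close>

lemma bilateral_cong_exp: "exp u = exp w \<Longrightarrow> bilateral a s u = bilateral a s w"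
  unfolding bilateral_def by (simp add: exp_minus exp_of_nat_mult)

lemma bilateral_minus:
  assumes "geom_growth R a" "R \<ge> 0" "u \<in> strip R" "s = 1 \<or> s = - 1"
  shows "bilateral a s (- u) = s * bilateral a s u"
  using assms(4) bilateral_eq_halves[OF assms(1-3), of s] bilateral_eq_halves[OF assms(1,2), of "- u" s] assms(3)
  by auto

lemma zeta_cong_exp:
  assumes "exp u = exp w"
  shows "zeta0 q u = zeta0 q w" "zeta1 q u = zeta1 q w" "heat0 q u = heat0 q w" "heat1 q u = heat1 q w"
  by (simp_all add: zeta0_def zeta1_def heat0_def heat1_def assms bilateral_cong_exp[OF assms])

lemma zeta_minus:
  assumes "norm q < 1" "u \<in> strip (norm q)" "exp u \<noteq> 1"
  shows "zeta0 q (- u) = - zeta0 q u" "zeta1 q (- u) = zeta1 q u"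
    "heat0 q (- u) = heat0 q u" "heat1 q (- u) = - heat1 q u"
proof -
  note gg = geom_growth_lambert[OF assms(1)] geom_growth_lambert_sq[OF assms(1)]
  note gn = gg[THEN geom_growth_mult_n]
  show "zeta0 q (- u) = - zeta0 q u" "zeta1 q (- u) = zeta1 q u"
    using bilateral_minus[OF gg(1) _ assms(2), of "-1"] bilateral_minus[OF gn(1) _ assms(2), of 1] assms(3)
    by (auto simp: zeta0_def zeta1_def exp_minus divide_simps power2_eq_square) (simp_all add: algebra_simps)
  show "heat0 q (- u) = heat0 q u" "heat1 q (- u) = - heat1 q u"
    using bilateral_minus[OF gg(2) _ assms(2), of "1"] bilateral_minus[OF gn(2) _ assms(2), of "-1"]
    by (auto simp: heat0_def heat1_def)
qed

text \<open>Representatives of the points of order dividing six: \<open>exp (torsion k)\<close> is the \<open>k\<close>-th power of the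
  primitive sixth root of unity \<open>exp (\<i> \<pi> / 3)\<close>.\<close>

definition torsion :: "nat \<Rightarrow> complex" where "torsion k = \<i> * of_real (of_nat k * pi / 3)"

lemma Re_torsion [simp]: "Re (torsion k) = 0"
  by (simp add: torsion_def)

lemma exp_torsion_eq_1_iff: "exp (torsion k) = 1 \<longleftrightarrow> 6 dvd k"
proof -
  have "exp (torsion k) = 1 \<longleftrightarrow> (\<exists>n::int. of_nat k * pi / 3 = of_int (2 * n) * pi)"
    by (simp add: exp_eq_1 torsion_def)
  also have "\<dots> \<longleftrightarrow> (\<exists>n::int. real_of_int (int k) = real_of_int (6 * n))"
    by (intro ex_cong1) (auto simp: field_simps)
  also have "\<dots> \<longleftrightarrow> (6::int) dvd int k"
    unfolding of_int_eq_iff by (auto simp: dvd_def)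
  also have "\<dots> \<longleftrightarrow> 6 dvd k" by presburger
  finally show ?thesis .
qed

lemma torsion_add: "torsion k + torsion l = torsion (k + l)"
  by (simp add: torsion_def algebra_simps add_divide_distrib)

lemma exp_torsion_reflect: "k + l = 6 \<Longrightarrow> exp (torsion k) = exp (- torsion l)"
proof -
  assume "k + l = 6"
  then have "exp (torsion k) * exp (torsion l) = 1"
    by (simp add: torsion_add exp_torsion_eq_1_iff flip: exp_add)
  then show ?thesis by (simp add: exp_minus field_simps)
qed

text \<open>\<open>eisX\<close> and \<open>eisY\<close> are Eisenstein series of weight one that generate the ring of modular forms for
  \<open>\<Gamma>\<^sub>1(6)\<close>, and \<open>eisQ\<close> is the quasimodular series \<open>- E\<^sub>2 / 12\<close>.\<close>

definition eisX where "eisX q = zeta0 q (torsion 1)"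
definition eisY where "eisY q = zeta0 q (torsion 2)"
definition eisQ where "eisQ q = heat0 q 0 - 1 / 12"

text \<open>Three instances of the addition theorem determine \<open>heat0\<close> at the points of order 6, 3 and 2; the
  Riccati equation then gives \<open>zeta1\<close>, and the differentiated addition theorem gives \<open>heat1\<close> and
  \<open>heat2\<close>. Since \<open>zeta0\<close> and \<open>zeta2\<close> are odd and \<open>2\<pi>\<i>\<close>-periodic they vanish at \<open>\<pi>\<i>\<close>, which is why every
  value that occurs is a polynomial in \<open>X\<close>, \<open>Y\<close>, \<open>Q\<close>.\<close>

lemma torsion_relations:
  assumes q: "norm q < 1" "q \<noteq> 0"
  defines "X \<equiv> eisX q" and "Y \<equiv> eisY q" and "Q \<equiv> eisQ q"
  shows "heat0 q (torsion 1) = (X\<^sup>2 - 2 * X * Y - Y\<^sup>2) / 2 + 1 / 12"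
    and "heat0 q (torsion 2) = Y\<^sup>2 + 1 / 12"
    and "zeta1 q (torsion 3) = - X\<^sup>2 + 4 * X * Y - Y\<^sup>2 + Q"
    and "heat1 q (torsion 1) = X * (X\<^sup>2 - X * Y - 5 * Y\<^sup>2 - Q)"
    and "heat1 q (torsion 2) = X ^ 3 - 3 * X\<^sup>2 * Y + Y ^ 3 - Y * Q"
    and "heat2 q (torsion 3) = (2 * X\<^sup>2 - 2 * X * Y - Y\<^sup>2 + Q) * (3 * Y\<^sup>2 + Q)
      - (- X\<^sup>2 + 4 * X * Y - Y\<^sup>2 + Q) * (2 * X\<^sup>2 - 2 * X * Y + 2 * Y\<^sup>2 + 2 * Q)"
proof -
  have s: "torsion k \<in> strip (norm q)" for k using q by (simp add: imaginary_in_strip)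
  have nz: "exp (torsion 1) \<noteq> 1" "exp (torsion 2) \<noteq> 1" "exp (torsion 3) \<noteq> 1" "exp (torsion 4) \<noteq> 1" "exp (torsion 5) \<noteq> 1"
    unfolding exp_torsion_eq_1_iff by auto
  have refl: "exp (torsion 4) = exp (- torsion 2)" "exp (torsion 5) = exp (- torsion 1)" "exp (torsion 3) = exp (- torsion 3)"
    by (rule exp_torsion_reflect, simp)+
  have tadd: "torsion 1 + torsion 1 = torsion 2" "torsion 1 + torsion 2 = torsion 3" "torsion 2 + torsion 2 = torsion 4"
    "torsion 3 + torsion 1 = torsion 4" "torsion 3 + torsion 2 = torsion 5"
    unfolding torsion_add by (simp_all add: eval_nat_numeral)
  note mins = zeta_minus[OF q(1) s nz(1)] zeta_minus[OF q(1) s nz(2)] zeta_minus[OF q(1) s nz(3)]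
  note ev = zeta_cong_exp[OF refl(1), of q] zeta_cong_exp[OF refl(2), of q]
  note ev = ev[unfolded mins]
  have z3: "zeta0 q (torsion 3) = 0" and h3: "heat1 q (torsion 3) = 0"
    using zeta_cong_exp(1,4)[OF refl(3), of q] unfolding mins by simp_all
  have e3: "exp (torsion 3) = - 1" by (simp add: torsion_def exp_eq_polar)
  have "zeta2 q (torsion 3) = 0"
    by (simp add: zeta2_def bilateral_def exp_minus exp_of_nat_mult e3 flip: power_inverse)
  note z = this z3 h3
  note XY = X_def[unfolded eisX_def, symmetric] Y_def[unfolded eisY_def, symmetric]
  have A: "3 * heat0 q (torsion 2) = 3 * Y\<^sup>2 + 1 / 4"
    using zeta_addition[OF q Re_torsion nz(2) Re_torsion nz(2)] nz unfolding tadd ev z XY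
    by (simp add: algebra_simps power2_eq_square)
  have B: "heat0 q (torsion 3) = X * Y + 1 / 4 - heat0 q (torsion 1) - heat0 q (torsion 2)"
    using zeta_addition[OF q Re_torsion nz(1) Re_torsion nz(2)] nz unfolding tadd ev z XY
    by (simp add: algebra_simps)
  have C: "2 * heat0 q (torsion 1) = X\<^sup>2 - 2 * X * Y + 1 / 4 - heat0 q (torsion 2)"
    using zeta_addition[OF q Re_torsion nz(1) Re_torsion nz(1)] nz unfolding tadd ev z XY
    by (simp add: algebra_simps power2_eq_square)
  have div: "x = y / c" if "c * x = y" "c \<noteq> 0" for x y c :: complex
    using that by (auto simp: field_simps)
  show H2: "heat0 q (torsion 2) = Y\<^sup>2 + 1 / 12" by (rule trans[OF div[OF A]]) (simp_all add: add_divide_distrib)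
  from C have "2 * heat0 q (torsion 1) = X\<^sup>2 - 2 * X * Y - Y\<^sup>2 + 1 / 6"
    unfolding H2 by simp
  from div[OF this] show H1: "heat0 q (torsion 1) = (X\<^sup>2 - 2 * X * Y - Y\<^sup>2) / 2 + 1 / 12"
    by (rule trans) (simp_all add: add_divide_distrib)
  have H3: "2 * heat0 q (torsion 3) = - X\<^sup>2 + 4 * X * Y - Y\<^sup>2 + 1 / 6"
    unfolding B H1 H2 by (simp add: field_simps)
  have Q: "heat0 q 0 = Q + 1 / 12" by (simp add: Q_def eisQ_def)
  have H1': "2 * heat0 q (torsion 1) = X\<^sup>2 - 2 * X * Y - Y\<^sup>2 + 1 / 6"
    unfolding H1 by (simp add: field_simps)
  have Z1: "zeta1 q (torsion 1) = 2 * X\<^sup>2 - 2 * X * Y - Y\<^sup>2 + Q"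
    using zeta_riccati[OF q Re_torsion nz(1)] unfolding H1' Q XY by simp
  have Z2: "zeta1 q (torsion 2) = 3 * Y\<^sup>2 + Q"
    using zeta_riccati[OF q Re_torsion nz(2)] unfolding H2 Q XY by simp
  show Z3: "zeta1 q (torsion 3) = - X\<^sup>2 + 4 * X * Y - Y\<^sup>2 + Q"
    using zeta_riccati[OF q Re_torsion nz(3)] unfolding H3 Q z by simp
  have "zeta1 q (torsion 3) * X - zeta1 q (torsion 2) * X + Y * zeta1 q (torsion 3) = - heat1 q (torsion 2)"
    using zeta_addition_deriv[OF q Re_torsion nz(3) Re_torsion nz(1)] nz unfolding tadd ev z XY by simp
  then have E2: "heat1 q (torsion 2) = - (zeta1 q (torsion 3) * X - zeta1 q (torsion 2) * X + Y * zeta1 q (torsion 3))"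
    by simp
  show "heat1 q (torsion 2) = X ^ 3 - 3 * X\<^sup>2 * Y + Y ^ 3 - Y * Q"
    unfolding E2 Z2 Z3 by (simp add: algebra_simps power2_eq_square power3_eq_cube)
  have "zeta1 q (torsion 3) * Y - zeta1 q (torsion 1) * Y + X * zeta1 q (torsion 3) = - heat1 q (torsion 1)"
    using zeta_addition_deriv[OF q Re_torsion nz(3) Re_torsion nz(2)] nz unfolding tadd ev z XY by simp
  then have E1: "heat1 q (torsion 1) = - (zeta1 q (torsion 3) * Y - zeta1 q (torsion 1) * Y + X * zeta1 q (torsion 3))"
    by simp
  show "heat1 q (torsion 1) = X * (X\<^sup>2 - X * Y - 5 * Y\<^sup>2 - Q)"
    unfolding E1 Z1 Z3 by (simp add: algebra_simps power2_eq_square power3_eq_cube)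
  have "zeta1 q (torsion 1) * zeta1 q (torsion 2) - zeta1 q (torsion 3) * (zeta1 q (torsion 1) + zeta1 q (torsion 2)) = heat2 q (torsion 3)"
    using zeta_addition_deriv2[OF q Re_torsion nz(1) Re_torsion nz(2)] nz unfolding tadd z by simp
  then have E3: "heat2 q (torsion 3) = zeta1 q (torsion 1) * zeta1 q (torsion 2) - zeta1 q (torsion 3) * (zeta1 q (torsion 1) + zeta1 q (torsion 2))"
    by simp
  show "heat2 q (torsion 3) = (2 * X\<^sup>2 - 2 * X * Y - Y\<^sup>2 + Q) * (3 * Y\<^sup>2 + Q)
      - (- X\<^sup>2 + 4 * X * Y - Y\<^sup>2 + Q) * (2 * X\<^sup>2 - 2 * X * Y + 2 * Y\<^sup>2 + 2 * Q)"
    unfolding E3 Z1 Z2 Z3 by (simp add: algebra_simps)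
qed

section \<open>Differential equations in the modular variable\<close>

abbreviation twopii :: complex where "twopii \<equiv> 2 * of_real pi * \<i>"

definition nome :: "complex \<Rightarrow> complex" where "nome \<tau> = exp (twopii * \<tau>)"

lemma nome_nonzero [simp]: "nome \<tau> \<noteq> 0" by (simp add: nome_def)

lemma norm_nome_less_1: "\<tau> \<in> upper_half_plane \<Longrightarrow> norm (nome \<tau>) < 1"
  by (simp add: nome_def upper_half_plane_def)

lemma has_field_derivative_nome: "(nome has_field_derivative twopii * nome \<tau>) (at \<tau>)"
  unfolding nome_def[abs_def] by (auto intro!: derivative_eq_intros)

text \<open>In the variable \<open>\<tau>\<close> the operator \<open>q d/dq\<close> is \<open>1 / (2\<pi>\<i>) d/d\<tau>\<close>. The weight \<open>c\<close> covers both \<open>zeta0\<close>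
  (\<open>c = 1\<close>) and \<open>zeta1\<close> (\<open>c n = n\<close>).\<close>

lemma has_field_derivative_bilateral_nome:
  assumes c: "geom_growth 1 c" and u: "Re u = 0" and s: "norm s \<le> 1" and t: "\<tau> \<in> upper_half_plane"
  shows "((\<lambda>\<tau>. bilateral (\<lambda>n. c n * lambert_coeff (nome \<tau>) n) s u) has_field_derivative
    twopii * bilateral (\<lambda>n. c n * (of_nat n * lambert_coeff_sq (nome \<tau>) n)) s u) (at \<tau>)"
proof -
  define b where "b = (\<lambda>n. c n * (exp (of_nat n * u) + s * exp (- (of_nat n * u))))"
  have b: "geom_growth 1 b"
    unfolding geom_growth_def
  proof (intro allI impI)
    fix r :: real assume "r > 1"
    then obtain C where "\<And>n. norm (c n) \<le> C * r ^ n" using c unfolding geom_growth_def by blast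
    then have "norm (b n) \<le> 2 * (C * r ^ n) * 1 ^ n" for n
      unfolding b_def using u s by (intro bilateral_summand_bound) auto
    then show "\<exists>C. \<forall>n. norm (b n) \<le> C * r ^ n" by (intro exI[of _ "2 * C"]) (simp add: mult.assoc)
  qed
  note q = norm_nome_less_1[OF t]
  note D = has_field_derivative_lambert_series[OF b q]
  have "((\<lambda>\<tau>. \<Sum>n. b n * lambert_coeff (nome \<tau>) n) has_field_derivative
     (\<Sum>n. b n * (of_nat n * nome \<tau> ^ (n - 1) / (1 - nome \<tau> ^ n)\<^sup>2)) * (twopii * nome \<tau>)) (at \<tau>)"
    using DERIV_chain2[OF D(1) has_field_derivative_nome] .
  also have "(\<Sum>n. b n * (of_nat n * nome \<tau> ^ (n - 1) / (1 - nome \<tau> ^ n)\<^sup>2)) * (twopii * nome \<tau>)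
    = twopii * (\<Sum>n. b n * (of_nat n * nome \<tau> ^ (n - 1) / (1 - nome \<tau> ^ n)\<^sup>2) * nome \<tau>)"
    using suminf_mult2[OF D(2), of "nome \<tau>"] by simp
  also have "(\<lambda>n. b n * (of_nat n * nome \<tau> ^ (n - 1) / (1 - nome \<tau> ^ n)\<^sup>2) * nome \<tau>)
     = (\<lambda>n. b n * (of_nat n * lambert_coeff_sq (nome \<tau>) n))"
  proof
    fix n show "b n * (of_nat n * nome \<tau> ^ (n - 1) / (1 - nome \<tau> ^ n)\<^sup>2) * nome \<tau> = b n * (of_nat n * lambert_coeff_sq (nome \<tau>) n)"
      by (cases n) (auto simp: lambert_coeff_sq_def)
  qed
  finally show ?thesis by (simp add: bilateral_def b_def mult_ac)
qed

lemma geom_growth_const: "geom_growth 1 (\<lambda>n. 1)"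
  by (rule geom_growth_le[of _ 1]) auto

lemma has_field_derivative_zeta0_nome:
  assumes "Re u = 0" "\<tau> \<in> upper_half_plane"
  shows "((\<lambda>\<tau>. zeta0 (nome \<tau>) u) has_field_derivative twopii * heat1 (nome \<tau>) u) (at \<tau>)"
  using DERIV_add[OF DERIV_const has_field_derivative_bilateral_nome[OF geom_growth_const assms(1) _ assms(2), of "-1"]]
  by (simp add: zeta0_def heat1_def)

lemma has_field_derivative_zeta1_nome:
  assumes "Re u = 0" "\<tau> \<in> upper_half_plane"
  shows "((\<lambda>\<tau>. zeta1 (nome \<tau>) u) has_field_derivative twopii * heat2 (nome \<tau>) u) (at \<tau>)"
  using DERIV_add[OF DERIV_const has_field_derivative_bilateral_nome[OF geom_growth_mult_n[OF geom_growth_const] assms(1) _ assms(2), of 1]]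
  by (simp add: zeta1_def heat2_def)

lemma open_upper_half_plane: "open upper_half_plane"
  unfolding upper_half_plane_def by (rule open_halfspace_Im_gt)

context
  fixes \<tau> X Y Q assumes t: "\<tau> \<in> upper_half_plane"
  defines "X \<equiv> eisX (nome \<tau>)" and "Y \<equiv> eisY (nome \<tau>)" and "Q \<equiv> eisQ (nome \<tau>)"
begin

lemma has_field_derivative_eisX:
  "((\<lambda>\<tau>. eisX (nome \<tau>)) has_field_derivative twopii * (X * (X\<^sup>2 - X * Y - 5 * Y\<^sup>2 - Q))) (at \<tau>)"
  using has_field_derivative_zeta0_nome[OF Re_torsion t, of 1] torsion_relations(4)[OF norm_nome_less_1[OF t] nome_nonzero]
  by (simp add: eisX_def X_def Y_def Q_def)

lemma has_field_derivative_eisY: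
  "((\<lambda>\<tau>. eisY (nome \<tau>)) has_field_derivative twopii * (X ^ 3 - 3 * X\<^sup>2 * Y + Y ^ 3 - Y * Q)) (at \<tau>)"
  using has_field_derivative_zeta0_nome[OF Re_torsion t, of 2] torsion_relations(5)[OF norm_nome_less_1[OF t] nome_nonzero]
  by (simp add: eisY_def X_def Y_def Q_def)

text \<open>Ramanujan's equation for the derivative of \<open>E\<^sub>2\<close>, with \<open>E\<^sub>4\<close> expressed through \<open>X\<close> and \<open>Y\<close>. It is read
  off from the value of \<open>zeta1\<close> at the point of order 2, which is \<open>Q\<close> plus a quadratic form in \<open>X\<close>
  and \<open>Y\<close> and whose derivative is \<open>heat2\<close>.\<close>

lemma has_field_derivative_eisQ:
  "((\<lambda>\<tau>. eisQ (nome \<tau>)) has_field_derivative twopii *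
     (6 * X\<^sup>2 * Y\<^sup>2 - 2 * X ^ 3 * Y + Y ^ 4 - Q\<^sup>2)) (at \<tau>)"
proof (rule has_field_derivative_transform_within_open[OF _ open_upper_half_plane t])
  show "zeta1 (nome z) (torsion 3) + (eisX (nome z))\<^sup>2 - 4 * eisX (nome z) * eisY (nome z) + (eisY (nome z))\<^sup>2
      = eisQ (nome z)" if "z \<in> upper_half_plane" for z
    using torsion_relations(3)[OF norm_nome_less_1[OF that] nome_nonzero] by simp
  show "((\<lambda>z. zeta1 (nome z) (torsion 3) + (eisX (nome z))\<^sup>2 - 4 * eisX (nome z) * eisY (nome z) + (eisY (nome z))\<^sup>2)
      has_field_derivative twopii *
     (6 * X\<^sup>2 * Y\<^sup>2 - 2 * X ^ 3 * Y + Y ^ 4 - Q\<^sup>2)) (at \<tau>)"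
    using has_field_derivative_zeta1_nome[OF Re_torsion t, of 3]
    unfolding torsion_relations(6)[OF norm_nome_less_1[OF t] nome_nonzero] X_def[symmetric] Y_def[symmetric] Q_def[symmetric]
    by (auto intro!: derivative_eq_intros has_field_derivative_eisX has_field_derivative_eisY
         simp: X_def[symmetric] Y_def[symmetric])
       (simp add: algebra_simps eval_nat_numeral)
qed

end

section \<open>The Euler product and its logarithmic derivative\<close>

text \<open>The factor \<open>\<Prod> (1 - q^n)\<close> of the eta function as a function of the nome, which unlike \<open>\<eta>\<close> itself is
  holomorphic also at \<open>q = 0\<close>.\<close>

definition euler_product :: "complex \<Rightarrow> complex" where
  "euler_product q = (\<Prod>n. 1 - q ^ Suc n)"

lemma convergent_euler_product: "norm (q::complex) < 1 \<Longrightarrow> convergent_prod (\<lambda>n. 1 - q ^ Suc n)"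
  by (intro abs_convergent_prod_imp_convergent_prod summable_imp_abs_convergent_prod)
     (simp add: norm_mult norm_power summable_geometric summable_mult)

lemma euler_product_nonzero: "norm q < 1 \<Longrightarrow> euler_product q \<noteq> 0"
  unfolding euler_product_def
  by (intro prodinf_nonzero convergent_euler_product one_minus_power_nonzero) auto

lemma euler_product_0: "euler_product 0 = 1"
  by (simp add: euler_product_def)

lemma uniform_limit_euler_product:
  assumes "r < 1"
  shows "uniform_limit (cball 0 r) (\<lambda>N q. \<Prod>n<N. 1 - q ^ Suc n) euler_product sequentially"
proof (cases "r \<ge> 0")
  case True
  have "uniformly_convergent_on (cball 0 r) (\<lambda>N q::complex. \<Prod>n<N. 1 - q ^ Suc n)"
  proof (rule uniformly_convergent_on_prod')
    show "uniformly_convergent_on (cball 0 r) (\<lambda>N q::complex. \<Sum>n<N. norm (1 - q ^ Suc n - 1))"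
    proof (rule Weierstrass_m_test')
      show "summable (\<lambda>n. r ^ Suc n)" using True assms by (simp add: summable_geometric summable_mult)
      show "norm (norm (1 - q ^ Suc n - 1)) \<le> r ^ Suc n" if "q \<in> cball 0 r" for q :: complex and n
      proof -
        have "norm q ^ Suc n \<le> r ^ Suc n" using that by (intro power_mono) auto
        then show ?thesis by (simp add: norm_mult norm_power)
      qed
    qed
  qed (auto intro!: continuous_intros)
  then obtain l where l: "uniform_limit (cball 0 r) (\<lambda>N q::complex. \<Prod>n<N. 1 - q ^ Suc n) l sequentially"
    by (auto simp: uniformly_convergent_on_def)
  have "l q = euler_product q" if "q \<in> cball 0 r" for q
  proof (rule LIMSEQ_unique)
    show "(\<lambda>N. \<Prod>n<N. 1 - q ^ Suc n) \<longlonglongrightarrow> l q" using tendsto_uniform_limitI[OF l that] .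
    show "(\<lambda>N. \<Prod>n<N. 1 - q ^ Suc n) \<longlonglongrightarrow> euler_product q"
      unfolding LIMSEQ_lessThan_iff_atMost euler_product_def
      using that assms by (intro convergent_prod_LIMSEQ convergent_euler_product) auto
  qed
  then show ?thesis using l uniform_limit_cong'[of "cball 0 r" "\<lambda>N q. \<Prod>n<N. 1 - q ^ Suc n" _ l euler_product] by auto
qed (auto simp: uniform_limit_on_empty)

lemma holomorphic_euler_product: "euler_product holomorphic_on ball 0 1"
proof (rule holomorphic_uniform_sequence[OF open_ball, where f = "\<lambda>N q. \<Prod>n<N. 1 - q ^ Suc n"])
  fix x :: complex assume x: "x \<in> ball 0 1"
  have sub: "cball x ((1 - norm x) / 2) \<subseteq> cball 0 ((1 + norm x) / 2)"
  proof
    fix y assume "y \<in> cball x ((1 - norm x) / 2)"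
    then show "y \<in> cball 0 ((1 + norm x) / 2)"
      using norm_triangle_ineq2[of y x] by (auto simp: dist_norm norm_minus_commute field_simps)
  qed
  show "\<exists>d>0. cball x d \<subseteq> ball 0 1 \<and> uniform_limit (cball x d) (\<lambda>N q. \<Prod>n<N. 1 - q ^ Suc n) euler_product sequentially"
    using x sub uniform_limit_on_subset[OF uniform_limit_euler_product sub]
    by (intro exI[of _ "(1 - norm x) / 2"]) (auto simp: subset_iff field_simps)
qed (auto intro!: holomorphic_intros)

lemma summable_lambert_coeff_sq: "norm q < 1 \<Longrightarrow> summable (\<lambda>n. norm (lambert_coeff_sq q n))"
  using bilateral_summable_norm[OF geom_growth_lambert_sq, of q 0] by (simp add: strip_def)

text \<open>Both sides are the double series of \<open>n q^(n m)\<close> over \<open>n, m \<ge> 1\<close>, summed by rows and by columns.\<close>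

lemma lambert_series_exchange:
  assumes q: "norm q < 1"
  shows "((\<lambda>n. of_nat n * lambert_coeff q n) has_sum (\<Sum>m. lambert_coeff_sq q m)) UNIV"
proof -
  define t where "t = (\<lambda>(n, m). of_nat n * q ^ (n * m))"
  have S2: "(lambert_coeff_sq q has_sum (\<Sum>m. lambert_coeff_sq q m)) UNIV"
    using norm_summable_imp_has_sum[OF summable_lambert_coeff_sq[OF q]] summable_norm_cancel[OF summable_lambert_coeff_sq[OF q]]
    by (simp add: summable_sums)
  then have S2: "(lambert_coeff_sq q has_sum (\<Sum>m. lambert_coeff_sq q m)) {1..}"
    by (rule iffD1[OF has_sum_cong_neutral, rotated -1]) (auto simp: lambert_coeff_sq_def Suc_le_eq)
  have qn: "norm (q ^ n) < 1" if "n \<in> {1..}" for n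
    using that q by (simp add: norm_power power_less_one_iff)
  have row: "((\<lambda>m. t (n, m)) has_sum (of_nat n * lambert_coeff q n)) {1..}" if "n \<in> {1..}" for n
    using has_sum_cmult_right[OF has_sum_geometric_from_1[OF qn[OF that]], of "of_nat n"]
    by (simp add: t_def lambert_coeff_def power_mult)
  have col: "((\<lambda>n. t (n, m)) has_sum lambert_coeff_sq q m) {1..}" if "m \<in> {1..}" for m
  proof -
    define z where "z = q ^ m"
    have z: "norm z < 1" using qn[OF that] by (simp add: z_def)
    have "summable (\<lambda>n. norm (of_nat n * z ^ n))"
      using bilateral_summable_norm[OF geom_growth_mult_n[OF geom_growth_le[of "\<lambda>n. z ^ n" 1 "norm z"]], of 0] z
      by (simp add: norm_power strip_def)
    moreover have "(\<lambda>n. of_nat n * z ^ n) sums (z / (1 - z)\<^sup>2)"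
      using sums_mult[OF geometric_deriv_sums[OF z], of z] by (subst sums_Suc_iff[symmetric, where f = "\<lambda>n. of_nat n * z ^ n", simplified]) (simp add: mult_ac)
    ultimately have "((\<lambda>n. of_nat n * z ^ n) has_sum (z / (1 - z)\<^sup>2)) UNIV"
      by (rule norm_summable_imp_has_sum)
    then have "((\<lambda>n. of_nat n * z ^ n) has_sum (z / (1 - z)\<^sup>2)) {1..}"
      by (rule iffD1[OF has_sum_cong_neutral, rotated -1]) (auto simp: Suc_le_eq)
    then show ?thesis by (simp add: t_def lambert_coeff_sq_def z_def power_mult[symmetric] mult.commute)
  qed
  have "(\<lambda>x. norm (t x)) summable_on ({1..} \<times> {1..})"
  proof (rule summable_on_SigmaI)
    fix n :: nat assume n: "n \<in> {1..}"
    have "norm (norm q ^ n) < 1" using qn[OF n] by (simp add: norm_power)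
    from has_sum_cmult_right[OF has_sum_geometric_from_1[OF this], of "real n"]
    show "((\<lambda>m. norm (t (n, m))) has_sum (real n * (norm q ^ n / (1 - norm q ^ n)))) {1..}"
      by (simp add: t_def norm_mult norm_power power_mult)
  next
    have "summable (\<lambda>n. norm (of_nat n * lambert_coeff (of_real (norm q)) n * exp (of_nat n * 0)))"
      by (rule bilateral_summable_norm[OF geom_growth_mult_n[OF geom_growth_lambert]]) (use q in \<open>auto simp: strip_def\<close>)
    then have "(\<lambda>n. norm (of_nat n * lambert_coeff (of_real (norm q)) n)) summable_on UNIV"
      by (intro norm_summable_imp_summable_on) simp
    then have "(\<lambda>n. norm (of_nat n * lambert_coeff (of_real (norm q)) n)) summable_on {1..}"
      by (rule summable_on_subset_banach) simp
    moreover have "norm (of_nat n * lambert_coeff (of_real (norm q)) n) = real n * (norm q ^ n / (1 - norm q ^ n))"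
      if "n \<in> {1..}" for n
    proof -
      have "norm q ^ n < 1" using qn[OF that] by (simp add: norm_power)
      then have "norm (1 - complex_of_real (norm q) ^ n) = 1 - norm q ^ n"
        by (metis norm_of_real of_real_1 of_real_diff of_real_power abs_of_nonneg diff_ge_0_iff_ge less_imp_le)
      then show ?thesis by (simp add: lambert_coeff_def norm_mult norm_divide norm_power)
    qed
    ultimately show "(\<lambda>n. real n * (norm q ^ n / (1 - norm q ^ n))) summable_on {1..}"
      by (subst (asm) summable_on_cong) auto
  qed auto
  then have summ: "t summable_on ({1..} \<times> {1..})" by (rule Infinite_Sum.abs_summable_summable)
  then obtain S where S: "(t has_sum S) ({1..} \<times> {1..})" by (auto simp: summable_on_def)
  have "((\<lambda>n. of_nat n * lambert_coeff q n) has_sum S) {1..}"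
    by (rule has_sum_SigmaD[OF S row])
  moreover have "(lambert_coeff_sq q has_sum S) {1..}"
    by (rule has_sum_SigmaD[OF S[unfolded has_sum_swap[of t]]]) (use col in auto)
  ultimately have "((\<lambda>n. of_nat n * lambert_coeff q n) has_sum (\<Sum>m. lambert_coeff_sq q m)) {1..}"
    using has_sum_unique[OF _ S2] by metis
  then show ?thesis
    by (rule iffD1[OF has_sum_cong_neutral, rotated -1]) (auto simp: lambert_coeff_def Suc_le_eq)
qed

text \<open>The logarithmic derivatives \<open>- n q^(n - 1) / (1 - q^n)\<close> of the factors add up to a Lambert series,
  which \<open>lambert_series_exchange\<close> rewrites with the coefficients that occur in \<open>heat0\<close>.\<close>

lemma has_field_derivative_euler_product:
  assumes q: "norm q < 1" "q \<noteq> 0"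
  shows "(euler_product has_field_derivative - euler_product q * (\<Sum>m. lambert_coeff_sq q m) / q) (at q)"
proof -
  have qb: "q \<in> ball 0 1" using q by simp
  have D: "(euler_product has_field_derivative deriv euler_product q) (at q)"
    using holomorphic_derivI[OF holomorphic_euler_product open_ball qb] .
  define r where "r = (1 + norm q) / 2"
  have r: "norm q < r" "r < 1" using q by (auto simp: r_def)
  have "uniform_limit (ball 0 r) (\<lambda>N q. \<Prod>n<N. 1 - q ^ Suc n) euler_product sequentially"
    by (rule uniform_limit_on_subset[OF uniform_limit_euler_product[OF r(2)]]) auto
  then have "(\<lambda>k. deriv (\<lambda>q. 1 - q ^ Suc k) q / (1 - q ^ Suc k)) sums (deriv euler_product q / euler_product q)"
    by (rule logderiv_prodinf_complex_uniform_limit)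
       (use q r euler_product_nonzero in \<open>auto intro!: holomorphic_intros\<close>)
  moreover have "deriv (\<lambda>q. 1 - q ^ Suc k) q = - (of_nat (Suc k) * q ^ k)" for k
    by (rule DERIV_imp_deriv) (auto intro!: derivative_eq_intros simp: mult.commute simp del: power_Suc)
  ultimately have "(\<lambda>k. - (of_nat (Suc k) * q ^ k) / (1 - q ^ Suc k)) sums (deriv euler_product q / euler_product q)"
    by simp
  from sums_mult[OF this, of "- q"]
  have "(\<lambda>k. of_nat (Suc k) * lambert_coeff q (Suc k)) sums (- q * (deriv euler_product q / euler_product q))"
    by (simp add: lambert_coeff_def mult_ac)
  then have "(\<lambda>n. of_nat n * lambert_coeff q n) sums (- q * (deriv euler_product q / euler_product q))"
    by (subst (asm) sums_Suc_iff) simp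
  moreover have "(\<lambda>n. of_nat n * lambert_coeff q n) sums (\<Sum>m. lambert_coeff_sq q m)"
    using lambert_series_exchange[OF q(1)] by (rule has_sum_imp_sums)
  ultimately have "(\<Sum>m. lambert_coeff_sq q m) = - q * (deriv euler_product q / euler_product q)"
    using sums_unique2 by blast
  then have "deriv euler_product q = - euler_product q * (\<Sum>m. lambert_coeff_sq q m) / q"
    using q(2) euler_product_nonzero[OF q(1)] by (simp add: field_simps)
  with D show ?thesis by simp
qed

text \<open>Since \<open>(q^k)^m = q^(k m)\<close>, a series in \<open>q^k\<close> is the part of the series in \<open>q\<close> that runs over the
  multiples of \<open>k\<close>. This puts the four levels 1, 2, 3, 6 on a common footing.\<close>

lemma lambert_multiples:
  assumes q: "norm q < 1" and k: "k > 0"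
  shows "(\<lambda>m. of_bool (k dvd m) * lambert_coeff_sq q m) sums (\<Sum>m. lambert_coeff_sq (q ^ k) m)"
proof -
  have "norm (q ^ k) < 1" using q k by (simp add: norm_power power_less_one_iff)
  then have "(lambert_coeff_sq (q ^ k) has_sum (\<Sum>m. lambert_coeff_sq (q ^ k) m)) UNIV"
    using norm_summable_imp_has_sum[OF summable_lambert_coeff_sq] summable_norm_cancel[OF summable_lambert_coeff_sq]
    by (simp add: summable_sums)
  then have "(lambert_coeff_sq q has_sum (\<Sum>m. lambert_coeff_sq (q ^ k) m)) {m. k dvd m}"
    by (rule iffD1[OF has_sum_reindex_bij_witness[of UNIV "\<lambda>m. m div k" "\<lambda>m. k * m" "{m. k dvd m}"], rotated -1])
       (use k in \<open>auto simp: lambert_coeff_sq_def power_mult\<close>)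
  then have "((\<lambda>m. of_bool (k dvd m) * lambert_coeff_sq q m) has_sum (\<Sum>m. lambert_coeff_sq (q ^ k) m)) UNIV"
    by (rule iffD1[OF has_sum_cong_neutral, rotated -1]) auto
  then show ?thesis by (rule has_sum_imp_sums)
qed

section \<open>The eta quotient\<close>

text \<open>The cyclotomic equation of a primitive sixth root of unity, which factors out of \<open>w^3 = - 1\<close>.\<close>

lemma exp_torsion_1_minimal: "(exp (torsion 1))\<^sup>2 = exp (torsion 1) - 1"
proof -
  have "exp (torsion 3) = - 1" by (simp add: torsion_def exp_eq_polar)
  moreover have "exp (torsion 3) = exp (torsion 1) ^ 3"
    by (simp add: torsion_def flip: exp_of_nat_mult)
  ultimately have "(exp (torsion 1) + 1) * ((exp (torsion 1))\<^sup>2 - exp (torsion 1) + 1) = 0"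
    by (simp add: algebra_simps power2_eq_square power3_eq_cube)
  moreover have "exp (torsion 1) + 1 \<noteq> 0"
  proof
    assume "exp (torsion 1) + 1 = 0"
    then have "exp (torsion 1) = - 1" by (simp add: eq_neg_iff_add_eq_0)
    moreover have "torsion 2 = torsion 1 + torsion 1" by (simp add: torsion_def)
    ultimately have "exp (torsion 2) = 1" by (simp only: exp_add) simp
    then show False unfolding exp_torsion_eq_1_iff by simp
  qed
  ultimately have "(exp (torsion 1))\<^sup>2 - exp (torsion 1) + 1 = 0" using mult_eq_0_iff by blast
  moreover have "(exp (torsion 1))\<^sup>2 = ((exp (torsion 1))\<^sup>2 - exp (torsion 1) + 1) + (exp (torsion 1) - 1)" by simp
  ultimately show ?thesis by (simp only: add_0)
qed

text \<open>The eta quotient \<open>f\<close> as a function of the nome.\<close>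

definition hauptmodul :: "complex \<Rightarrow> complex" where
  "hauptmodul q = (euler_product (q ^ 2) ^ 4 * euler_product (q ^ 3) ^ 8) /
     (euler_product q ^ 8 * euler_product (q ^ 6) ^ 4)"

text \<open>The exponential prefactors of the eta functions cancel because
  \<open>2 \<cdot> 4 + 3 \<cdot> 8 = 1 \<cdot> 8 + 6 \<cdot> 4\<close>.\<close>

lemma eta_quotient_eq_hauptmodul:
  assumes "z \<in> upper_half_plane"
  shows "(dedekind_eta (2 * z) ^ 4 * dedekind_eta (3 * z) ^ 8) /
     (dedekind_eta z ^ 8 * dedekind_eta (6 * z) ^ 4) = hauptmodul (nome z)"
proof -
  define e where "e = exp (twopii * z / 24)"
  have eta: "dedekind_eta (of_nat k * z) = e ^ k * euler_product (nome z ^ k)" for k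
  proof -
    have "exp (twopii * (of_nat k * z) / 24) = e ^ k"
      unfolding e_def exp_of_nat_mult[symmetric] by (simp add: algebra_simps)
    moreover have "exp (twopii * of_nat (Suc n) * (of_nat k * z)) = (nome z ^ k) ^ Suc n" for n
      unfolding nome_def exp_of_nat_mult[symmetric] by (simp only: mult_ac)
    ultimately show ?thesis by (simp only: dedekind_eta_def euler_product_def)
  qed
  have e: "e \<noteq> 0" by (simp add: e_def)
  show ?thesis using eta[of 1] eta[of 2] eta[of 3] eta[of 6] e
    by (simp add: hauptmodul_def power_mult_distrib power_mult[symmetric])
qed

text \<open>The left side collects the logarithmic derivatives of the four Euler products in \<open>f\<close>. Term by term
  the claim says that, for a primitive sixth root of unity \<open>w\<close>, the sum
  \<open>w^m + w^(-m) - w^(2m) - w^(-2m)\<close> depends only on which of 2, 3, 6 divide \<open>m\<close>. This reflects the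
  factorization \<open>f = \<Prod> ((1 + q^n + q^(2n)) / (1 - q^n + q^(2n)))^4\<close>.\<close>

lemma lambert_level_6:
  assumes q: "norm q < 1"
  shows "8 * (\<Sum>m. lambert_coeff_sq q m) - 8 * (\<Sum>m. lambert_coeff_sq (q ^ 2) m) - 24 * (\<Sum>m. lambert_coeff_sq (q ^ 3) m) + 24 * (\<Sum>m. lambert_coeff_sq (q ^ 6) m)
    = 4 * (heat0 q (torsion 1) - heat0 q (torsion 2))"
proof -
  define w where "w = exp (torsion 1)"
  have w2: "w ^ 2 = w - 1" using exp_torsion_1_minimal by (simp add: w_def)
  have "w ^ 3 = w ^ 2 * w" by (simp add: power3_eq_cube power2_eq_square)
  also have "\<dots> = w ^ 2 - w" unfolding w2 by (simp add: algebra_simps w2[unfolded power2_eq_square])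
  finally have w3: "w ^ 3 = - 1" using w2 by simp
  have w6: "w ^ 6 = 1" using w3 power_mult[of w 3 2] by simp
  have iw: "exp (- torsion 1) = w ^ 5" "exp (torsion 2) = w ^ 2" "exp (- torsion 2) = w ^ 4"
  proof -
    have "torsion 2 = torsion 1 + torsion 1" by (simp add: torsion_def)
    then show e2: "exp (torsion 2) = w ^ 2" by (simp only: w_def power2_eq_square exp_add)
    have "w * w ^ 5 = 1" "w ^ 2 * w ^ 4 = 1" using w6 by (simp_all flip: power_add power_Suc)
    then show "exp (- torsion 1) = w ^ 5" "exp (- torsion 2) = w ^ 4"
      unfolding exp_minus w_def[symmetric] e2 by (simp_all add: inverse_unique)
  qed
  have strip: "torsion k \<in> strip (norm q)" for k using q by (simp add: imaginary_in_strip)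
  have "(\<lambda>m. 8 * lambert_coeff_sq q m - 8 * (of_bool (2 dvd m) * lambert_coeff_sq q m) - 24 * (of_bool (3 dvd m) * lambert_coeff_sq q m)
      + 24 * (of_bool (6 dvd m) * lambert_coeff_sq q m)) sums
     (8 * (\<Sum>m. lambert_coeff_sq q m) - 8 * (\<Sum>m. lambert_coeff_sq (q ^ 2) m) - 24 * (\<Sum>m. lambert_coeff_sq (q ^ 3) m) + 24 * (\<Sum>m. lambert_coeff_sq (q ^ 6) m))"
    using lambert_multiples[OF q, of 1]
    by (intro sums_add sums_diff sums_mult lambert_multiples[OF q]) auto
  moreover have "(\<lambda>m. 4 * (lambert_coeff_sq q m * (exp (of_nat m * torsion 1) + 1 * exp (- (of_nat m * torsion 1)))
      - lambert_coeff_sq q m * (exp (of_nat m * torsion 2) + 1 * exp (- (of_nat m * torsion 2))))) sums (4 * (heat0 q (torsion 1) - heat0 q (torsion 2)))"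
    unfolding heat0_def using q strip by (intro sums_mult sums_diff bilateral_sums[OF geom_growth_lambert_sq]) auto
  moreover have "8 * lambert_coeff_sq q m - 8 * (of_bool (2 dvd m) * lambert_coeff_sq q m) - 24 * (of_bool (3 dvd m) * lambert_coeff_sq q m)
      + 24 * (of_bool (6 dvd m) * lambert_coeff_sq q m) = 4 * (lambert_coeff_sq q m * (exp (of_nat m * torsion 1) + 1 * exp (- (of_nat m * torsion 1)))
      - lambert_coeff_sq q m * (exp (of_nat m * torsion 2) + 1 * exp (- (of_nat m * torsion 2))))" for m
  proof -
    \<comment> \<open>a sixth root of unity sees only the residue of \<open>m\<close> modulo 6\<close>
    define r where "r = m mod 6"
    have pw: "w ^ (k * m) = w ^ (k * r)" for k
    proof -
      define d where "d = m div 6"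
      have m: "m = 6 * d + r" by (simp add: d_def r_def)
      have "k * m = 6 * (k * d) + k * r" unfolding m by (simp add: algebra_simps)
      then have "w ^ (k * m) = (w ^ 6) ^ (k * d) * w ^ (k * r)" by (simp only: power_add power_mult)
      then show ?thesis by (simp add: w6)
    qed
    have "exp (of_nat m * torsion 1) + exp (- (of_nat m * torsion 1)) - exp (of_nat m * torsion 2) - exp (- (of_nat m * torsion 2))
       = w ^ (1 * m) + w ^ (5 * m) - w ^ (2 * m) - w ^ (4 * m)"
      using exp_of_nat_mult[of m "torsion 1"] exp_of_nat_mult[of m "- torsion 1"] exp_of_nat_mult[of m "torsion 2"] exp_of_nat_mult[of m "- torsion 2"]
      unfolding iw w_def[symmetric] by (simp add: power_mult)
    also have "\<dots> = w ^ r + w ^ (5 * r) - w ^ (2 * r) - w ^ (4 * r)" unfolding pw by simp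
    also have "\<dots> = 2 - 2 * of_bool (2 dvd r) - 6 * of_bool (3 dvd r) + 6 * of_bool (6 dvd r)"
    proof -
      have red: "w ^ (6 + k) = w ^ k" for k by (simp add: power_add w6)
      have w4: "w ^ 4 = - w" using w3 power_add[of w 3 1] by simp
      have w5: "w ^ 5 = 1 - w" using w3 w2 power_add[of w 3 2] by simp
      have w8: "w ^ 8 = w - 1" using red[of 2] w2 by simp
      have w10: "w ^ 10 = - w" using red[of 4] w4 by simp
      have w12: "w ^ 12 = 1" using red[of 6] w6 by simp
      have w15: "w ^ 15 = - 1" using red[of 9] red[of 3] w3 by simp
      have w16: "w ^ 16 = - w" using red[of 10] w10 by simp
      have w20: "w ^ 20 = w - 1" using red[of 14] red[of 8] w8 by simp
      have w25: "w ^ 25 = w" using red[of 19] red[of 13] red[of 7] red[of 1] by simp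
      have "r \<in> {0, 1, 2, 3, 4, 5}" by (auto simp: r_def)
      then show ?thesis
        by (auto simp: w2 w3 w4 w5 w6 w8 w10 w12 w15 w16 w20 w25)
    qed
    also have "2 dvd r \<longleftrightarrow> 2 dvd m" by (simp add: r_def dvd_mod_iff)
    also have "3 dvd r \<longleftrightarrow> 3 dvd m" by (simp add: r_def dvd_mod_iff)
    also have "6 dvd r \<longleftrightarrow> 6 dvd m" by (simp add: r_def dvd_mod_iff)
    finally have E: "exp (of_nat m * torsion 1) + exp (- (of_nat m * torsion 1)) - exp (of_nat m * torsion 2) - exp (- (of_nat m * torsion 2))
       = 2 - 2 * of_bool (2 dvd m) - 6 * of_bool (3 dvd m) + 6 * of_bool (6 dvd m)" .
    have "4 * (lambert_coeff_sq q m * (exp (of_nat m * torsion 1) + 1 * exp (- (of_nat m * torsion 1)))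
      - lambert_coeff_sq q m * (exp (of_nat m * torsion 2) + 1 * exp (- (of_nat m * torsion 2)))) =
       4 * lambert_coeff_sq q m * (exp (of_nat m * torsion 1) + exp (- (of_nat m * torsion 1)) - exp (of_nat m * torsion 2) - exp (- (of_nat m * torsion 2)))"
      by (simp add: algebra_simps)
    then show ?thesis unfolding E by (simp add: algebra_simps)
  qed
  ultimately show ?thesis using sums_unique2 by simp
qed

lemma has_field_derivative_euler_product_power:
  assumes q: "norm q < 1" "q \<noteq> 0" and k: "k > 0"
  shows "((\<lambda>q. euler_product (q ^ k)) has_field_derivative
     - (of_nat k * (\<Sum>m. lambert_coeff_sq (q ^ k) m) / q) * euler_product (q ^ k)) (at q)"
proof -
  have "norm (q ^ k) < 1" "q ^ k \<noteq> 0" using q k by (auto simp: norm_power power_less_one_iff)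
  from DERIV_chain2[OF has_field_derivative_euler_product[OF this] DERIV_power[OF DERIV_ident, of k]]
  have "((\<lambda>q. euler_product (q ^ k)) has_field_derivative
     - euler_product (q ^ k) * (\<Sum>m. lambert_coeff_sq (q ^ k) m) / q ^ k * (of_nat k * q ^ (k - 1))) (at q)"
    by simp
  also have "- euler_product (q ^ k) * (\<Sum>m. lambert_coeff_sq (q ^ k) m) / q ^ k * (of_nat k * q ^ (k - 1))
     = - (of_nat k * (\<Sum>m. lambert_coeff_sq (q ^ k) m) / q) * euler_product (q ^ k)"
    using q k by (cases k) auto
  finally show ?thesis .
qed

lemma has_field_derivative_hauptmodul:
  assumes q: "norm q < 1" "q \<noteq> 0"
  shows "(hauptmodul has_field_derivative hauptmodul q * (4 * (heat0 q (torsion 1) - heat0 q (torsion 2))) / q) (at q)"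
proof -
  note D = has_field_derivative_euler_product_power[OF q]
  have nz: "euler_product (q ^ k) \<noteq> 0" if "k > 0" for k
    using that q by (intro euler_product_nonzero) (auto simp: norm_power power_less_one_iff)
  define A B C E where "A = euler_product (q ^ 2)" and "B = euler_product (q ^ 3)"
    and "C = euler_product q" and "E = euler_product (q ^ 6)"
  define a b c e where "a = - (2 * (\<Sum>m. lambert_coeff_sq (q ^ 2) m) / q)" and "b = - (3 * (\<Sum>m. lambert_coeff_sq (q ^ 3) m) / q)"
    and "c = - ((\<Sum>m. lambert_coeff_sq q m) / q)" and "e = - (6 * (\<Sum>m. lambert_coeff_sq (q ^ 6) m) / q)"
  have D': "((\<lambda>q. euler_product (q ^ 2)) has_field_derivative a * A) (at q)"
    "((\<lambda>q. euler_product (q ^ 3)) has_field_derivative b * B) (at q)"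
    "(euler_product has_field_derivative c * C) (at q)"
    "((\<lambda>q. euler_product (q ^ 6)) has_field_derivative e * E) (at q)"
    using D[of 2] D[of 3] D[of 1] D[of 6] by (simp_all add: A_def B_def C_def E_def a_def b_def c_def e_def)
  have nz': "A \<noteq> 0" "B \<noteq> 0" "C \<noteq> 0" "E \<noteq> 0"
    using nz[of 2] nz[of 3] nz[of 1] nz[of 6] by (auto simp: A_def B_def C_def E_def)
  have "(hauptmodul has_field_derivative (A ^ 4 * B ^ 8) / (C ^ 8 * E ^ 4) * (4 * a + 8 * b - 8 * c - 4 * e)) (at q)"
    unfolding hauptmodul_def[abs_def]
    by (rule derivative_eq_intros D' refl | fold A_def B_def C_def E_def | use nz' in simp; fail)+
       (use nz' in \<open>simp add: divide_simps; simp add: algebra_simps eval_nat_numeral\<close>)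
  also have "(A ^ 4 * B ^ 8) / (C ^ 8 * E ^ 4) = hauptmodul q"
    by (simp add: hauptmodul_def A_def B_def C_def E_def)
  also have "4 * a + 8 * b - 8 * c - 4 * e = (4 * (heat0 q (torsion 1) - heat0 q (torsion 2))) / q"
    unfolding lambert_level_6[OF q(1), symmetric] a_def b_def c_def e_def using q(2) by (simp add: field_simps)
  finally show ?thesis by simp
qed

section \<open>The Schwarzian equation\<close>

text \<open>Both solutions are constant multiples of \<open>exp B\<close> for a primitive \<open>B\<close> of the coefficient \<open>b\<close>.\<close>

lemma linear_ode_proportional:
  assumes S: "open S" "convex S" and b: "b holomorphic_on S"
    and y: "\<And>z. z \<in> S \<Longrightarrow> (y has_field_derivative b z * y z) (at z)"
    and w: "\<And>z. z \<in> S \<Longrightarrow> (w has_field_derivative b z * w z) (at z)"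
    and z: "z1 \<in> S" "z2 \<in> S"
  shows "y z1 * w z2 = y z2 * w z1"
proof -
  obtain B where B: "\<And>z. z \<in> S \<Longrightarrow> (B has_field_derivative b z) (at z within S)"
    using holomorphic_convex_primitive'[OF S(2,1) b] by blast
  have const: "f z1 * exp (- B z1) = f z2 * exp (- B z2)"
    if f: "\<And>z. z \<in> S \<Longrightarrow> (f has_field_derivative b z * f z) (at z)" for f
  proof -
    have "\<exists>c. \<forall>z\<in>S. f z * exp (- B z) = c"
    proof (rule has_field_derivative_zero_constant[OF S(2)])
      fix z assume z: "z \<in> S"
      show "((\<lambda>z. f z * exp (- B z)) has_field_derivative 0) (at z within S)"
        by (rule derivative_eq_intros B[OF z] has_field_derivative_at_within[OF f[OF z]] refl)+
           (simp add: algebra_simps)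
    qed
    then show ?thesis using z by metis
  qed
  have "(y z1 * exp (- B z1)) * (w z2 * exp (- B z2)) = (y z2 * exp (- B z2)) * (w z1 * exp (- B z1))"
    by (simp only: const[of y, OF y] const[of w, OF w])
  then have "(y z1 * w z2) * (exp (- B z1) * exp (- B z2)) = (y z2 * w z1) * (exp (- B z1) * exp (- B z2))"
    by (simp only: mult_ac)
  moreover have "exp (- B z1) * exp (- B z2) \<noteq> 0" by simp
  ultimately show ?thesis using mult_right_cancel by blast
qed

lemma isCont_zeta0_at_0:
  assumes "Re u = 0"
  shows "isCont (\<lambda>q. zeta0 q u) 0" and "zeta0 0 u = (1 + exp u) / (2 * (1 - exp u))"
proof -
  define b where "b = (\<lambda>n. exp (of_nat n * u) + (- 1) * exp (- (of_nat n * u)))"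
  have "geom_growth 1 b"
  proof (rule geom_growth_le)
    show "norm (b n) \<le> 2 * 1 ^ n" for n
      using bilateral_summand_bound[of "\<lambda>_. 1" n 1 u 1 "-1"] assms by (simp add: b_def)
  qed simp
  from has_field_derivative_lambert_series(1)[OF this, of 0]
  have "isCont (\<lambda>q. \<Sum>n. b n * lambert_coeff q n) 0" by (auto dest: DERIV_isCont)
  moreover have "zeta0 q u = (1 + exp u) / (2 * (1 - exp u)) + (\<Sum>n. b n * lambert_coeff q n)" for q
    by (simp add: zeta0_def bilateral_def b_def mult.commute)
  ultimately show "isCont (\<lambda>q. zeta0 q u) 0" by simp
  have "lambert_coeff 0 n = 0" for n by (cases n) (auto simp: lambert_coeff_def)
  then show "zeta0 0 u = (1 + exp u) / (2 * (1 - exp u))" by (simp add: zeta0_def bilateral_def)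
qed

text \<open>At \<open>q = 0\<close> only the rational terms of \<open>zeta0\<close> remain. The ratio 3 is the value of \<open>X / Y\<close> at the cusp
  \<open>\<i>\<infinity>\<close>, where \<open>f = 1\<close>.\<close>

lemma eis_at_0: "eisX 0 = 3 * eisY 0" "eisX 0 \<noteq> 0"
proof -
  define w where "w = exp (torsion 1)"
  have w2: "w * w = w - 1" using exp_torsion_1_minimal by (simp add: w_def power2_eq_square)
  have "torsion 2 = torsion 1 + torsion 1" by (simp add: torsion_def)
  then have e2: "exp (torsion 2) = w - 1" by (simp only: w_def[symmetric] exp_add w2)
  have n1: "1 - w \<noteq> 0" using exp_torsion_eq_1_iff[of 1] by (auto simp: w_def)
  have n2: "2 - w \<noteq> 0"
  proof
    assume "2 - w = 0" then have "w = 2" by simp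
    with w2 show False by simp
  qed
  have n3: "1 + w \<noteq> 0"
  proof
    assume "1 + w = 0" then have "w = - 1" by (simp add: eq_neg_iff_add_eq_0 add.commute)
    with w2 show False by simp
  qed
  have X: "eisX 0 = (1 + w) / (2 * (1 - w))"
    unfolding eisX_def isCont_zeta0_at_0(2)[OF Re_torsion] w_def ..
  have Y: "eisY 0 = w / (2 * (2 - w))"
    unfolding eisY_def isCont_zeta0_at_0(2)[OF Re_torsion] e2 by simp
  have "(1 + w) * (2 * (2 - w)) = 3 * w * (2 * (1 - w))" using w2 by algebra
  then have "(1 + w) / (2 * (1 - w)) = 3 * w / (2 * (2 - w))" using n1 n2 by (subst frac_eq_eq) auto
  then show "eisX 0 = 3 * eisY 0" unfolding X Y by simp
  show "eisX 0 \<noteq> 0" unfolding X using n1 n3 by simp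
qed

lemma isCont_hauptmodul_0: "isCont hauptmodul 0" and hauptmodul_0: "hauptmodul 0 = 1"
proof -
  have c: "isCont euler_product 0"
    using holomorphic_on_imp_continuous_on[OF holomorphic_euler_product]
    by (simp add: continuous_on_eq_continuous_at)
  have "isCont (\<lambda>q. euler_product (q ^ k)) 0" if "k > 0" for k
    by (rule isCont_o2[where g = euler_product]) (use c that in \<open>auto simp: zero_power\<close>)
  from this[of 2] this[of 3] this[of 6] c show "isCont hauptmodul 0"
    unfolding hauptmodul_def[abs_def] by (intro continuous_intros) (auto simp: euler_product_0)
  show "hauptmodul 0 = 1" by (simp add: hauptmodul_def euler_product_0)
qed

lemma has_field_derivative_hauptmodul_nome:
  assumes t: "\<tau> \<in> upper_half_plane"
  defines "X \<equiv> eisX (nome \<tau>)" and "Y \<equiv> eisY (nome \<tau>)"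
  shows "((\<lambda>\<tau>. hauptmodul (nome \<tau>)) has_field_derivative
    twopii * (hauptmodul (nome \<tau>) * (2 * (X - 3 * Y) * (X + Y)))) (at \<tau>)"
proof -
  note q = norm_nome_less_1[OF t] nome_nonzero[of \<tau>]
  have "4 * (heat0 (nome \<tau>) (torsion 1) - heat0 (nome \<tau>) (torsion 2)) = 2 * (X - 3 * Y) * (X + Y)"
    unfolding torsion_relations(1,2)[OF q] X_def Y_def by (simp add: field_simps power2_eq_square)
  then have E: "hauptmodul (nome \<tau>) * (4 * (heat0 (nome \<tau>) (torsion 1) - heat0 (nome \<tau>) (torsion 2))) / nome \<tau> *
      (twopii * nome \<tau>) = twopii * (hauptmodul (nome \<tau>) * (2 * (X - 3 * Y) * (X + Y)))"
    by (simp only:) simp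
  show ?thesis
    using DERIV_chain2[OF has_field_derivative_hauptmodul[OF q] has_field_derivative_nome[of \<tau>]] unfolding E .
qed

lemma convex_upper_half_plane: "convex upper_half_plane"
  unfolding upper_half_plane_def by (rule convex_halfspace_Im_gt)

text \<open>This is \<open>f = X / (3 (X - 2 Y))\<close>, cleared of denominators. The shape is forced by the cusps: \<open>f\<close>
  takes the values \<open>0, \<infinity>, 1, 1/9\<close> where \<open>X / Y\<close> takes the values \<open>0, 2, 3, - 1\<close>. The difference \<open>E\<close> of
  the two sides and \<open>X\<close> itself satisfy the same linear differential equation, hence are
  proportional; as \<open>\<tau> \<rightarrow> \<i>\<infinity>\<close>, \<open>E\<close> tends to \<open>0\<close> but \<open>X\<close> does not, so \<open>E = 0\<close>.\<close>

lemma hauptmodul_eq_eis: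
  assumes t: "\<tau> \<in> upper_half_plane"
  shows "3 * hauptmodul (nome \<tau>) * (eisX (nome \<tau>) - 2 * eisY (nome \<tau>)) = eisX (nome \<tau>)"
proof -
  define X Y Q f where "X = (\<lambda>\<tau>. eisX (nome \<tau>))" and "Y = (\<lambda>\<tau>. eisY (nome \<tau>))"
    and "Q = (\<lambda>\<tau>. eisQ (nome \<tau>))" and "f = (\<lambda>\<tau>. hauptmodul (nome \<tau>))"
  define b where "b = (\<lambda>\<tau>. twopii * ((X \<tau>)\<^sup>2 - X \<tau> * Y \<tau> - 5 * (Y \<tau>)\<^sup>2 - Q \<tau>))"
  define E where "E = (\<lambda>\<tau>. 3 * f \<tau> * (X \<tau> - 2 * Y \<tau>) - X \<tau>)"
  have DX: "(X has_field_derivative twopii * (X z * ((X z)\<^sup>2 - X z * Y z - 5 * (Y z)\<^sup>2 - Q z))) (at z)"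
    and DY: "(Y has_field_derivative twopii * (X z ^ 3 - 3 * (X z)\<^sup>2 * Y z + Y z ^ 3 - Y z * Q z)) (at z)"
    and DQ: "(Q has_field_derivative twopii * (6 * (X z)\<^sup>2 * (Y z)\<^sup>2 - 2 * X z ^ 3 * Y z + Y z ^ 4 - (Q z)\<^sup>2)) (at z)"
    if "z \<in> upper_half_plane" for z
    using has_field_derivative_eisX[OF that] has_field_derivative_eisY[OF that] has_field_derivative_eisQ[OF that]
    unfolding X_def Y_def Q_def .
  have Df: "(f has_field_derivative twopii * (f z * (2 * (X z - 3 * Y z) * (X z + Y z)))) (at z)"
    if "z \<in> upper_half_plane" for z
    using has_field_derivative_hauptmodul_nome[OF that] unfolding X_def Y_def f_def .
  have hol: "X holomorphic_on upper_half_plane" "Y holomorphic_on upper_half_plane" "Q holomorphic_on upper_half_plane"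
    using DX DY DQ open_upper_half_plane by (auto simp: holomorphic_on_open)
  have b: "b holomorphic_on upper_half_plane"
    unfolding b_def by (intro holomorphic_intros hol)
  have X': "(X has_field_derivative b z * X z) (at z)" if "z \<in> upper_half_plane" for z
    using DX[OF that] by (simp only: b_def mult_ac)
  have E': "(E has_field_derivative b z * E z) (at z)" if z: "z \<in> upper_half_plane" for z
    unfolding E_def b_def
    by (rule derivative_eq_intros Df[OF z] DX[OF z] DY[OF z] refl)+
       (simp add: algebra_simps power2_eq_square power3_eq_cube)
  have propor: "E \<tau> * X s = E s * X \<tau>" if "s \<in> upper_half_plane" for s
    by (rule linear_ode_proportional[OF open_upper_half_plane convex_upper_half_plane b E' X' t that])
  have nome0: "((\<lambda>t. nome (\<i> * of_real t)) \<longlongrightarrow> 0) at_top"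
  proof -
    have eq: "nome (\<i> * of_real t) = of_real (exp (- (2 * pi * t)))" for t
      by (simp add: nome_def exp_of_real[symmetric] algebra_simps)
    have "((\<lambda>t. exp (- (2 * pi * t))) \<longlongrightarrow> 0) at_top" by real_asymp
    from tendsto_of_real[OF this] show ?thesis unfolding eq by simp
  qed
  have limX: "((\<lambda>t. X (\<i> * of_real t)) \<longlongrightarrow> eisX 0) at_top"
    unfolding X_def eisX_def by (rule isCont_tendsto_compose[OF isCont_zeta0_at_0(1)[OF Re_torsion] nome0])
  have limY: "((\<lambda>t. Y (\<i> * of_real t)) \<longlongrightarrow> eisY 0) at_top"
    unfolding Y_def eisY_def by (rule isCont_tendsto_compose[OF isCont_zeta0_at_0(1)[OF Re_torsion] nome0])
  have limf: "((\<lambda>t. f (\<i> * of_real t)) \<longlongrightarrow> 1) at_top"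
    unfolding f_def using isCont_tendsto_compose[OF isCont_hauptmodul_0 nome0] by (simp add: hauptmodul_0)
  have "((\<lambda>t. E (\<i> * of_real t)) \<longlongrightarrow> 3 * 1 * (eisX 0 - 2 * eisY 0) - eisX 0) at_top"
    unfolding E_def by (intro tendsto_intros limX limY limf)
  then have "((\<lambda>t. E (\<i> * of_real t) * X \<tau>) \<longlongrightarrow> 0 * X \<tau>) at_top"
    by (intro tendsto_intros) (simp add: eis_at_0(1))
  moreover have "((\<lambda>t. E \<tau> * X (\<i> * of_real t)) \<longlongrightarrow> E \<tau> * eisX 0) at_top"
    by (intro tendsto_intros limX)
  moreover have "\<forall>\<^sub>F t in at_top. E \<tau> * X (\<i> * complex_of_real t) = E (\<i> * of_real t) * X \<tau>"
    using eventually_gt_at_top[of 0] by eventually_elim (intro propor, simp add: upper_half_plane_def)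
  ultimately have "E \<tau> * eisX 0 = 0 * X \<tau>"
    by (intro limits_eq_of_eventually_eq[where F = "at_top :: real filter"]) auto
  then show ?thesis using eis_at_0(2) by (simp add: E_def X_def Y_def f_def)
qed

text \<open>What remains of the Schwarzian equation after all derivatives have been eliminated: the first four
  lines are the derivative \<open>M\<close> of \<open>N = f'' / f'\<close> (in units of \<open>2\<pi>\<i>\<close>), the fifth is \<open>- N\<^sup>2 / 2\<close>, and the
  last one is the rational function of \<open>f\<close> times \<open>(f')\<^sup>2\<close>. The quasimodular \<open>q\<close> (standing for \<open>Q\<close>)
  cancels, as it must since the Schwarzian derivative of a modular function is modular.\<close>

lemma weight_4_identity:
  fixes x y q d :: complex
  assumes "d = x - 2 * y"
  shows "4 * x * (x * (x\<^sup>2 - x * y - 5 * y\<^sup>2 - q))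
       - 8 * (x * (x ^ 3 - 3 * x\<^sup>2 * y + y ^ 3 - y * q) + y * (x * (x\<^sup>2 - x * y - 5 * y\<^sup>2 - q)))
       - 8 * y * (x ^ 3 - 3 * x\<^sup>2 * y + y ^ 3 - y * q)
       - 2 * (6 * x\<^sup>2 * y\<^sup>2 - 2 * x ^ 3 * y + y ^ 4 - q\<^sup>2)
       - (2 * x\<^sup>2 - 8 * x * y - 4 * y\<^sup>2 - 2 * q)\<^sup>2 / 2
       + (9 / 8) * (x ^ 4 - 4 * x ^ 3 * d + 34 / 3 * x ^ 2 * d ^ 2 - 4 * x * d ^ 3 + d ^ 4) = 0"
  unfolding assms by (simp add: field_simps power2_eq_square power3_eq_cube power4_eq_xxxx)

lemma quartic_homogenized:
  fixes x d f :: complex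
  assumes "3 * f * d = x"
  shows "d ^ 4 * (81 * f ^ 4 - 108 * f ^ 3 + 102 * f ^ 2 - 12 * f + 1)
       = x ^ 4 - 4 * x ^ 3 * d + 34 / 3 * x ^ 2 * d ^ 2 - 4 * x * d ^ 3 + d ^ 4"
  unfolding assms[symmetric] by (simp add: algebra_simps power2_eq_square power3_eq_cube power4_eq_xxxx)

text \<open>The factors \<open>1 - 9 f\<close> and \<open>f - 1\<close> are, up to constants, the linear forms \<open>X + Y\<close> and \<open>X - 3 Y\<close> over \<open>d\<close>,
  and the same forms make up \<open>f' / f\<close>; so \<open>(f')\<^sup>2\<close> cancels the denominator up to a power of \<open>d\<close>.\<close>

lemma cusp_factors:
  fixes x y d f w :: complex
  assumes "3 * f * d = x" "d = x - 2 * y" "d \<noteq> 0"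
  shows "2 * (1 - 9 * f) ^ 2 * (f - 1) ^ 2 * f ^ 2 = (8 / 9) * (f * (2 * (x - 3 * y) * (x + y)))\<^sup>2 / d ^ 4"
proof -
  have "d * (1 - 9 * f) = d - 3 * (3 * f * d)" "3 * d * (f - 1) = 3 * f * d - 3 * d"
    by (simp_all add: algebra_simps)
  then have "d * (1 - 9 * f) = d - 3 * x" "3 * d * (f - 1) = x - 3 * d" unfolding assms(1) .
  then have "d * (1 - 9 * f) = - 2 * (x + y)" "3 * d * (f - 1) = - 2 * (x - 3 * y)"
    by (simp_all only:) (simp_all add: assms(2))
  moreover have "u = w / e" if "e * u = w" "e \<noteq> 0" for u w e :: complex
    using that by (auto simp: field_simps)
  ultimately have U: "1 - 9 * f = - 2 * (x + y) / d" and V: "f - 1 = - 2 * (x - 3 * y) / (3 * d)"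
    using assms(3) by (metis mult_eq_0_iff zero_neq_numeral)+
  have "2 * (- 2 * p / d)\<^sup>2 * (- 2 * r / (3 * d))\<^sup>2 * f\<^sup>2 = (8 / 9) * (f * (2 * r * p))\<^sup>2 / d ^ 4" for p r :: complex
    using assms(3) by (simp add: field_simps eval_nat_numeral)
  then show ?thesis unfolding U V .
qed

theorem theorem8p1:
  fixes f :: "complex \<Rightarrow> complex" and \<tau> :: complex
  assumes f_eq: "\<And>z. z \<in> upper_half_plane \<Longrightarrow>
      f z = (dedekind_eta (2 * z) ^ 4 * dedekind_eta (3 * z) ^ 8) /
            (dedekind_eta z ^ 8 * dedekind_eta (6 * z) ^ 4)"
    and "\<tau> \<in> upper_half_plane"
  shows "schwarzian f \<tau> +
      (81 * f \<tau> ^ 4 - 108 * f \<tau> ^ 3 + 102 * f \<tau> ^ 2 - 12 * f \<tau> + 1) /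
      (2 * (1 - 9 * f \<tau>) ^ 2 * (f \<tau> - 1) ^ 2 * f \<tau> ^ 2) * (deriv f \<tau>) ^ 2 = 0"
proof -
  note t = assms(2)
  have f: "f z = hauptmodul (nome z)" if "z \<in> upper_half_plane" for z
    using f_eq[OF that] eta_quotient_eq_hauptmodul[OF that] by simp
  define X Y Q where "X = (\<lambda>\<tau>. eisX (nome \<tau>))" and "Y = (\<lambda>\<tau>. eisY (nome \<tau>))"
    and "Q = (\<lambda>\<tau>. eisQ (nome \<tau>))"
  have DX: "(X has_field_derivative twopii * (X z * ((X z)\<^sup>2 - X z * Y z - 5 * (Y z)\<^sup>2 - Q z))) (at z)"
    and DY: "(Y has_field_derivative twopii * (X z ^ 3 - 3 * (X z)\<^sup>2 * Y z + Y z ^ 3 - Y z * Q z)) (at z)"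
    and DQ: "(Q has_field_derivative twopii * (6 * (X z)\<^sup>2 * (Y z)\<^sup>2 - 2 * X z ^ 3 * Y z + Y z ^ 4 - (Q z)\<^sup>2)) (at z)"
    if "z \<in> upper_half_plane" for z
    using has_field_derivative_eisX[OF that] has_field_derivative_eisY[OF that] has_field_derivative_eisQ[OF that]
    unfolding X_def Y_def Q_def .
  \<comment> \<open>\<open>W\<close>, \<open>N\<close> and \<open>M\<close> are \<open>f' / f\<close>, \<open>f'' / f'\<close> and the derivative of \<open>N\<close>, in units of \<open>2\<pi>\<i>\<close> per differentiation\<close>
  define W N M where "W = (\<lambda>z. 2 * (X z - 3 * Y z) * (X z + Y z))"
    and "N = (\<lambda>z. 2 * (X z)\<^sup>2 - 8 * X z * Y z - 4 * (Y z)\<^sup>2 - 2 * Q z)"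
    and "M = (\<lambda>z. 4 * X z * (X z * ((X z)\<^sup>2 - X z * Y z - 5 * (Y z)\<^sup>2 - Q z))
       - 8 * (X z * (X z ^ 3 - 3 * (X z)\<^sup>2 * Y z + Y z ^ 3 - Y z * Q z)
            + Y z * (X z * ((X z)\<^sup>2 - X z * Y z - 5 * (Y z)\<^sup>2 - Q z)))
       - 8 * Y z * (X z ^ 3 - 3 * (X z)\<^sup>2 * Y z + Y z ^ 3 - Y z * Q z)
       - 2 * (6 * (X z)\<^sup>2 * (Y z)\<^sup>2 - 2 * X z ^ 3 * Y z + Y z ^ 4 - (Q z)\<^sup>2))"
  have D1: "(f has_field_derivative twopii * (f z * W z)) (at z)" if z: "z \<in> upper_half_plane" for z
    unfolding f[OF z] W_def X_def Y_def
    by (rule has_field_derivative_transform_within_open[OF has_field_derivative_hauptmodul_nome[OF z] open_upper_half_plane z])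
       (simp add: f)
  have d1: "deriv f z = twopii * (f z * W z)" if "z \<in> upper_half_plane" for z
    using D1[OF that] by (rule DERIV_imp_deriv)
  have D2: "(deriv f has_field_derivative twopii * (deriv f z * N z)) (at z)" if z: "z \<in> upper_half_plane" for z
  proof (rule has_field_derivative_transform_within_open[OF _ open_upper_half_plane z d1[symmetric]])
    show "((\<lambda>z. twopii * (f z * W z)) has_field_derivative twopii * (deriv f z * N z)) (at z)"
      unfolding W_def
      by (rule derivative_eq_intros D1[OF z] DX[OF z] DY[OF z] refl)+
         (simp add: d1[OF z] N_def W_def algebra_simps power2_eq_square power3_eq_cube)
  qed
  have d2: "deriv (deriv f) z = twopii * (deriv f z * N z)" if "z \<in> upper_half_plane" for z
    using D2[OF that] by (rule DERIV_imp_deriv)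
  have D3: "(deriv (deriv f) has_field_derivative twopii\<^sup>2 * (deriv f \<tau> * ((N \<tau>)\<^sup>2 + M \<tau>))) (at \<tau>)"
  proof (rule has_field_derivative_transform_within_open[OF _ open_upper_half_plane t d2[symmetric]])
    have "(N has_field_derivative twopii * M \<tau>) (at \<tau>)"
      unfolding N_def M_def
      by (rule derivative_eq_intros DX[OF t] DY[OF t] DQ[OF t] refl)+ (simp add: algebra_simps)
    then show "((\<lambda>z. twopii * (deriv f z * N z)) has_field_derivative twopii\<^sup>2 * (deriv f \<tau> * ((N \<tau>)\<^sup>2 + M \<tau>))) (at \<tau>)"
      by (auto intro!: derivative_eq_intros D2[OF t] simp: algebra_simps power2_eq_square)
  qed
  show ?thesis
  proof (cases "deriv f \<tau> = 0")
    \<comment> \<open>where \<open>f'\<close> vanishes, both summands are \<open>0\<close> because division by zero yields zero\<close>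
    case True
    then show ?thesis by (simp add: schwarzian_def)
  next
    case False
    have d3: "(deriv ^^ 3) f \<tau> = deriv f \<tau> * (twopii\<^sup>2 * ((N \<tau>)\<^sup>2 + M \<tau>))"
      using DERIV_imp_deriv[OF D3] by (simp add: eval_nat_numeral)
    have d2': "(deriv ^^ 2) f \<tau> = deriv f \<tau> * (twopii * N \<tau>)"
      using d2[OF t] by (simp add: eval_nat_numeral)
    have cancel: "D * a / D - 3 / 2 * (D * n / D)\<^sup>2 = a - 3 / 2 * n\<^sup>2" if "D \<noteq> 0" for D a n :: complex
      using that by simp
    have S: "schwarzian f \<tau> = twopii\<^sup>2 * (M \<tau> - (N \<tau>)\<^sup>2 / 2)"
      unfolding schwarzian_def d3 d2' cancel[OF False] power_mult_distrib by (simp add: algebra_simps)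
    define x y d where "x = X \<tau>" and "y = Y \<tau>" and "d = X \<tau> - 2 * Y \<tau>"
    have eq: "3 * f \<tau> * d = x" using hauptmodul_eq_eis[OF t] by (simp add: f[OF t] d_def x_def X_def Y_def)
    have nz: "f \<tau> \<noteq> 0" "x - 3 * y \<noteq> 0" "x + y \<noteq> 0"
      using False unfolding d1[OF t] W_def x_def y_def by auto
    \<comment> \<open>\<open>d = 0\<close> would force \<open>X = 0\<close> and then \<open>Y = 0\<close>, hence \<open>f' = 0\<close>\<close>
    have d: "d \<noteq> 0"
    proof
      assume "d = 0"
      with eq have "x = 0" "y = 0" by (auto simp: d_def x_def y_def)
      with nz show False by simp
    qed
    have "(81 * f \<tau> ^ 4 - 108 * f \<tau> ^ 3 + 102 * f \<tau> ^ 2 - 12 * f \<tau> + 1) /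
      (2 * (1 - 9 * f \<tau>) ^ 2 * (f \<tau> - 1) ^ 2 * f \<tau> ^ 2) * (deriv f \<tau>) ^ 2
      = twopii\<^sup>2 * ((9 / 8) * (d ^ 4 * (81 * f \<tau> ^ 4 - 108 * f \<tau> ^ 3 + 102 * f \<tau> ^ 2 - 12 * f \<tau> + 1)))"
    proof -
      have cancel: "P / ((8 / 9) * v\<^sup>2 / d ^ 4) * (c * v)\<^sup>2 = c\<^sup>2 * ((9 / 8) * (d ^ 4 * P))"
        if "v \<noteq> 0" for P v c :: complex
        using that d by (simp add: power_mult_distrib)
      have den: "2 * (1 - 9 * f \<tau>) ^ 2 * (f \<tau> - 1) ^ 2 * f \<tau> ^ 2 = (8 / 9) * (f \<tau> * W \<tau>)\<^sup>2 / d ^ 4"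
        unfolding W_def x_def[symmetric] y_def[symmetric]
        by (rule cusp_factors[OF eq _ d]) (simp add: d_def x_def y_def)
      have "f \<tau> * W \<tau> \<noteq> 0" using nz by (simp add: W_def x_def y_def)
      then show ?thesis unfolding d1[OF t] den by (rule cancel)
    qed
    also have "d ^ 4 * (81 * f \<tau> ^ 4 - 108 * f \<tau> ^ 3 + 102 * f \<tau> ^ 2 - 12 * f \<tau> + 1)
       = x ^ 4 - 4 * x ^ 3 * d + 34 / 3 * x ^ 2 * d ^ 2 - 4 * x * d ^ 3 + d ^ 4"
      using quartic_homogenized[OF eq] .
    finally have R: "(81 * f \<tau> ^ 4 - 108 * f \<tau> ^ 3 + 102 * f \<tau> ^ 2 - 12 * f \<tau> + 1) /
      (2 * (1 - 9 * f \<tau>) ^ 2 * (f \<tau> - 1) ^ 2 * f \<tau> ^ 2) * (deriv f \<tau>) ^ 2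
      = twopii\<^sup>2 * ((9 / 8) * (x ^ 4 - 4 * x ^ 3 * d + 34 / 3 * x ^ 2 * d ^ 2 - 4 * x * d ^ 3 + d ^ 4))" .
    have "M \<tau> - (N \<tau>)\<^sup>2 / 2 + (9 / 8) * (x ^ 4 - 4 * x ^ 3 * d + 34 / 3 * x ^ 2 * d ^ 2 - 4 * x * d ^ 3 + d ^ 4) = 0"
      unfolding M_def N_def x_def by (rule weight_4_identity) (simp add: d_def)
    then show ?thesis unfolding S R distrib_left[symmetric] by simp
  qed
qed

end
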